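(* Let $f,g$ satisfy the standing assumptions below and let $\beta\ge\max\{\frac{8M_fQ_g}{\mu^3},\frac{4M_fQ_gL_g}{\mu^{3.5}}\}$. Consider Algorithm 3: from $(x_0,y_0)$, for $k=0,1,\dots$: compute $w_k$ with $\|\nabla^2_{yy}g(x_k,y_k)w_k-\nabla_yg(x_k,y_k)\|\le\varepsilon_{1,k}$; choose $(d_{x,k},d_{y,k})\in\mathcal{D}_f(x_k,y_k-w_k)$; set $p_{x,k}=d_{x,k}-\nabla^2_{xy}g(x_k,y_k)\nabla^2_{yy}g(x_k,y_k)^{-1}d_{y,k}$; set $x_{k+1}=x_k-\eta_kp_{x,k}$ and $y_{k+1}=y_k-\eta_k\big(\beta\nabla_yg(x_k,y_k)-\nabla^2_{yx}g(x_k,y_k)\nabla^2_{yy}g(x_k,y_k)^{-1}p_{x,k}\big)$. Suppose: (a) $\sup_k\|x_k\|+\|y_k\|<\infty$; (b) $\eta_k\ge0$, $\sum_k\eta_k=\infty$, $\sum_k\eta_k^2<\infty$; (c) the set $\{f(x,y):(x,y)\text{ is a }\mathcal{D}_f\text{-stationary point of (BLO)}\}$ has empty interior; and $\lim_k\varepsilon_{1,k}=0$. Then every limit point of $\{(x_k,y_k)\}$ is a $\mathcal{D}_f$-stationary point of (BLO), and $\{h(x_k,y_k)\}$ converges.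
   Context: Standing assumptions. (A1) Constants $M_f,\mu,L_g,Q_g>0$ exist such that: $f:\mathbb{R}^n\times\mathbb{R}^p\to\mathbb{R}$ is $M_f$-Lipschitz; $g$ is twice differentiable with $\nabla^2_{yy}g\succeq\mu I_p$; $\nabla g$ is $L_g$-Lipschitz; $\nabla^2_{yy}g,\nabla^2_{xy}g$ are $Q_g$-Lipschitz; $\nabla^2_{yy}g$ is continuously differentiable ($\nabla^2_{xy}g\in\mathbb{R}^{n\times p}$ has entries $\partial^2g/\partial x_i\partial y_j$, $\nabla^2_{yx}g$ is its transpose). (A2) $f$ is a potential function of a conservative field $\mathcal{D}_f$ with compact convex values of norm at most $M_f$ (conservative field: closed graph, nonempty compact values, $\int_0^1\max_{v\in\mathcal{D}(\gamma(t))}\langle\gamma'(t),v\rangle dt=0$ along every absolutely continuous loop; potential: $f(\gamma(1))-f(\gamma(0))$ equals this integral along any absolutely continuous curve). Notation: $\mathcal{A}(x,y):=y-\nabla^2_{yy}g(x,y)^{-1}\nabla_yg(x,y)$, $h(x,y):=f(x,\mathcal{A}(x,y))+\frac\beta2\|\nabla_yg(x,y)\|^2$. $(x,y)$ is a $\mathcal{D}_f$-stationary point of (BLO) (the problem $\min f(x,y)$ s.t. $y=\arg\min_{y'}g(x,y')$) if there is $(d_x,d_y)\in\mathcal{D}_f(x,y)$ with $d_x-\nabla^2_{xy}g(x,y)\nabla^2_{yy}g(x,y)^{-1}d_y=0$ and $\nabla_yg(x,y)=0$.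
   Formalization: In the update of y the printed product ∇²_yx g ∇²_yy g^{-1} p_x is undefined when n ≠ p (a p×n matrix times a p×p matrix); the formal statement uses the well-typed order ∇²_yy g^{-1} ∇²_yx g p_x instead. *)

theory Defs
  imports "HOL-Analysis.Analysis"
begin

definition abs_cont_01 :: "(real \<Rightarrow> 'a::real_normed_vector) \<Rightarrow> bool" where
  "abs_cont_01 \<gamma> \<longleftrightarrow>
     (\<forall>\<epsilon>>0. \<exists>\<delta>>0. \<forall>S :: (real \<times> real) set.
        finite S \<longrightarrow> (\<forall>(a,b)\<in>S. 0 \<le> a \<and> a < b \<and> b \<le> 1) \<longrightarrow>
        (\<forall>(a,b)\<in>S. \<forall>(c,d)\<in>S. (a,b) \<noteq> (c,d) \<longrightarrow> {a<..<b} \<inter> {c<..<d} = {}) \<longrightarrow>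
        (\<Sum>(a,b)\<in>S. b - a) < \<delta> \<longrightarrow> (\<Sum>(a,b)\<in>S. norm (\<gamma> b - \<gamma> a)) < \<epsilon>)"

definition field_integrand ::
  "('a::euclidean_space \<Rightarrow> 'a set) \<Rightarrow> (real \<Rightarrow> 'a) \<Rightarrow> real \<Rightarrow> real" where
  "field_integrand D \<gamma> t = Sup ((\<lambda>v. vector_derivative \<gamma> (at t) \<bullet> v) ` D (\<gamma> t))"

definition conservative_field :: "('a::euclidean_space \<Rightarrow> 'a set) \<Rightarrow> bool" where
  "conservative_field D \<longleftrightarrow>
     closed {(z, v). v \<in> D z} \<and>
     (\<forall>z. D z \<noteq> {} \<and> compact (D z)) \<and>
     (\<forall>\<gamma>. abs_cont_01 \<gamma> \<and> \<gamma> 0 = \<gamma> 1 \<longrightarrow> (field_integrand D \<gamma> has_integral 0) {0..1})"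

definition potential_of :: "('a::euclidean_space \<Rightarrow> real) \<Rightarrow> ('a \<Rightarrow> 'a set) \<Rightarrow> bool" where
  "potential_of f D \<longleftrightarrow>
     (\<forall>\<gamma>. abs_cont_01 \<gamma> \<longrightarrow> (field_integrand D \<gamma> has_integral (f (\<gamma> 1) - f (\<gamma> 0))) {0..1})"

definition opnorm :: "real^'m^'k \<Rightarrow> real" where
  "opnorm A = onorm (\<lambda>v. A *v v)"

text \<open>D_f-stationary point of (BLO). Hxy z is the n x p matrix of mixed second derivatives,
  Hyy z the p x p Hessian in y, gy z the gradient in y.\<close>
definition BLO_stationary ::
  "((real^'n) \<times> (real^'p) \<Rightarrow> ((real^'n) \<times> (real^'p)) set) \<Rightarrow>
   ((real^'n) \<times> (real^'p) \<Rightarrow> real^'p^'n) \<Rightarrow> ((real^'n) \<times> (real^'p) \<Rightarrow> real^'p^'p) \<Rightarrow>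
   ((real^'n) \<times> (real^'p) \<Rightarrow> real^'p) \<Rightarrow> (real^'n) \<times> (real^'p) \<Rightarrow> bool" where
  "BLO_stationary D Hxy Hyy gy z \<longleftrightarrow>
     (\<exists>dx dy. (dx, dy) \<in> D z \<and> dx - Hxy z *v (matrix_inv (Hyy z) *v dy) = 0) \<and> gy z = 0"

definition Amap ::
  "((real^'n) \<times> (real^'p) \<Rightarrow> real^'p^'p) \<Rightarrow> ((real^'n) \<times> (real^'p) \<Rightarrow> real^'p) \<Rightarrow>
   (real^'n) \<times> (real^'p) \<Rightarrow> real^'p" where
  "Amap Hyy gy z = snd z - matrix_inv (Hyy z) *v gy z"

definition hfun ::
  "((real^'n) \<times> (real^'p) \<Rightarrow> real) \<Rightarrow> real \<Rightarrow>
   ((real^'n) \<times> (real^'p) \<Rightarrow> real^'p^'p) \<Rightarrow> ((real^'n) \<times> (real^'p) \<Rightarrow> real^'p) \<Rightarrow>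
   (real^'n) \<times> (real^'p) \<Rightarrow> real" where
  "hfun f \<beta> Hyy gy z = f (fst z, Amap Hyy gy z) + \<beta> / 2 * (norm (gy z))\<^sup>2"

end

theory Submission
  imports Defs "HOL-Complex_Analysis.Great_Picard"
begin

text \<open>
  The iteration is an Euler discretisation of the differential inclusion \<open>z' \<in> - field z\<close>, where
  \<open>field z\<close> collects the update directions obtained from \<open>Df\<close> at \<open>(x, Amap (x, y))\<close>; it has closed
  convex values and closed graph, and \<open>0 \<in> field z\<close> means that \<open>z\<close> is stationary.
  By the Arzela--Ascoli theorem the interpolated iterates, started at later and later times, subconverge
  to Lipschitz curves, and a separating hyperplane shows that wherever such a curve is differentiable it
  solves the inclusion.  Lipschitz curves are differentiable almost everywhere (a Vitali covering
  argument), so the potential property applies along \<open>(x, Amap (x, y))\<close> and shows that \<open>hfun\<close> strictly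
  decreases along every solution that starts at a nonstationary point.  If \<open>hfun\<close> oscillated along the
  iterates, they would cross some noncritical value upwards infinitely often; a limit of these upcrossings
  would be a solution started at a nonstationary point along which \<open>hfun\<close> does not decrease.
  Once \<open>hfun\<close> converges, it is constant along every limiting solution, so limit points are stationary.
\<close>

section \<open>Lipschitz functions of one real variable\<close>

text \<open>The correction in the \<open>y\<close>-update is chosen so that, to first order, moving
  \<open>x\<close> along \<open>- px\<close> leaves \<open>gy\<close> unchanged; along the flow
  \<open>gy\<close> varies only by \<open>- \<beta>\<close> times \<open>Hyy\<close> applied to
  \<open>gy\<close>. The Newton correction inside \<open>Amap\<close> then varies by
  \<open>- \<beta> gy\<close> up to an error, which cancels the same term in the motion of
  \<open>y\<close>, and pairing the motion of \<open>(x, Amap)\<close> with the selected element of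
  \<open>Df\<close> yields minus the squared norm of \<open>px\<close>. The error stems from the
  variation of \<open>Hyy\<close>: it is at most \<open>Qg / \<mu>\<close> times the speed times the
  length of the Newton correction, and this length is at most the norm of \<open>gy\<close> over
  \<mu>. The two lower bounds on \<beta> serve to absorb the part of the error quadratic in
  \<open>gy\<close> and the part mixed in \<open>px\<close> and \<open>gy\<close>. Since
  \<open>f\<close> is nonsmooth, no single step has a descent estimate; the potential property
  speaks about curves only, which is why the iteration is compared with limit curves.\<close>

lemma Vitali_covering_intervals:
  fixes S :: "real set" and K :: "(real \<times> real) set"
  assumes S: "\<And>x d. \<lbrakk>x \<in> S; 0 < d\<rbrakk> \<Longrightarrow> \<exists>a b. (a, b) \<in> K \<and> a < x \<and> x < b \<and> b - a < d"
  obtains C where "countable C" "C \<subseteq> K"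
     "pairwise (\<lambda>i j. disjnt {fst i<..<snd i} {fst j<..<snd j}) C"
     "negligible (S - (\<Union>i\<in>C. {fst i<..<snd i}))"
proof -
  let ?c = "\<lambda>i::real \<times> real. (fst i + snd i) / 2" and ?r = "\<lambda>i::real \<times> real. (snd i - fst i) / 2"
  have ball: "ball (?c i) (?r i) = {fst i<..<snd i}" for i
    by (simp add: greaterThanLessThan_eq_ball)
  have "\<exists>i. i \<in> K \<and> x \<in> ball (?c i) (?r i) \<and> ?r i < d" if xd: "x \<in> S" "0 < d" for x d
  proof -
    obtain a b where "(a, b) \<in> K" "a < x" "x < b" "b - a < d"
      using S[OF xd] by blast
    then show ?thesis
      by (intro exI[of _ "(a, b)"]) (auto simp: ball[of "(a, b)", simplified])
  qed
  from Vitali_covering_theorem_balls[of S K ?c ?r, unfolded ball, OF this[unfolded ball]] that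
  show thesis by blast
qed

text \<open>Induction from the right: the interval with the largest left endpoint is split off, and
  all others fit between \<open>c\<close> and that endpoint.\<close>

lemma sum_increments_disjoint_intervals_le:
  fixes F :: "real \<Rightarrow> real"
  assumes "mono F" "finite C"
    and "\<And>i. i \<in> C \<Longrightarrow> c \<le> fst i \<and> fst i < snd i \<and> snd i \<le> d"
    and "pairwise (\<lambda>i j. disjnt {fst i<..<snd i} {fst j<..<snd j}) C" and "c \<le> d"
  shows "(\<Sum>i\<in>C. F (snd i) - F (fst i)) \<le> F d - F c"
  using assms(2-)
proof (induction "card C" arbitrary: C d)
  case 0
  then show ?case using \<open>mono F\<close> by (auto simp: mono_def)
next
  case (Suc n)
  then have "C \<noteq> {}" by auto
  then have "Max (fst ` C) \<in> fst ` C" using Suc.prems(1) by (intro Max_in) auto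
  then obtain i where i0: "i \<in> C" "fst i = Max (fst ` C)" by auto
  then have i: "i \<in> C" "\<And>j. j \<in> C \<Longrightarrow> fst j \<le> fst i" using Suc.prems(1) by auto
  have left: "snd j \<le> fst i" if "j \<in> C - {i}" for j
  proof (rule ccontr)
    assume "\<not> snd j \<le> fst i"
    \<comment> \<open>Otherwise the midpoint of the overlap would belong to both open
      intervals.\<close>
    then have "(fst i + min (snd i) (snd j)) / 2 \<in> {fst i<..<snd i} \<inter> {fst j<..<snd j}"
      using i(2)[of j] that Suc.prems(2)[of j] Suc.prems(2)[OF i(1)] by (auto simp: min_def)
    moreover have "disjnt {fst i<..<snd i} {fst j<..<snd j}"
      using Suc.prems(3) i(1) that by (auto simp: pairwise_def)
    ultimately show False by (auto simp: disjnt_def)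
  qed
  have "(\<Sum>j\<in>C - {i}. F (snd j) - F (fst j)) \<le> F (fst i) - F c"
  proof (rule Suc.hyps(1))
    show "n = card (C - {i})" using Suc i by simp
    show "pairwise (\<lambda>i j. disjnt {fst i<..<snd i} {fst j<..<snd j}) (C - {i})"
      using Suc.prems(3) by (rule pairwise_subset) auto
  qed (use Suc.prems i left in auto)
  moreover have "F (snd i) \<le> F d" using \<open>mono F\<close> Suc.prems(2)[OF i(1)] by (auto simp: mono_def)
  ultimately show ?case
    using i Suc.prems(1) by (simp add: sum.remove)
qed

section \<open>Differentiability almost everywhere\<close>

lemma outer_cover_of_steep_points:
  fixes F :: "real \<Rightarrow> real"
  assumes F: "mono F" and q: "0 < q" and cd: "c < d"
    and steep: "\<And>t e. \<lbrakk>t \<in> E; 0 < e\<rbrakk> \<Longrightarrow>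
      \<exists>a b. a < t \<and> t < b \<and> b - a < e \<and> q * (b - a) < F b - F a"
  shows "\<exists>V. E \<inter> {c<..<d} \<subseteq> V \<and> V \<in> lmeasurable \<and> measure lebesgue V \<le> (F d - F c) / q"
proof -
  let ?K = "{(a, b). c \<le> a \<and> a < b \<and> b \<le> d \<and> q * (b - a) < F b - F a}"
  have cov: "\<exists>a b. (a, b) \<in> ?K \<and> a < t \<and> t < b \<and> b - a < e" if t: "t \<in> E \<inter> {c<..<d}" "0 < e" for t e
  proof -
    \<comment> \<open>Besides being short, the interval must stay inside \<open>{c..d}\<close>, so
      that its increment counts towards \<open>F d - F c\<close>.\<close>
    have "0 < Min {e, t - c, d - t}" using t by auto
    then obtain a b where ab: "a < t" "t < b" "b - a < Min {e, t - c, d - t}"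
      "q * (b - a) < F b - F a"
      using steep[of t "Min {e, t - c, d - t}"] t by blast
    have "b - a < e" "b - a < t - c" "b - a < d - t" using ab(3) by auto
    then show ?thesis using ab
      by (intro exI[of _ a] exI[of _ b]) auto
  qed
  obtain C where C: "countable C" "C \<subseteq> ?K"
     "pairwise (\<lambda>i j. disjnt {fst i<..<snd i} {fst j<..<snd j}) C"
     "negligible (E \<inter> {c<..<d} - (\<Union>i\<in>C. {fst i<..<snd i}))"
    by (rule Vitali_covering_intervals[of "E \<inter> {c<..<d}" ?K, OF cov])
  let ?B = "(F d - F c) / q"
  have fin: "measure lebesgue (\<Union>i\<in>D. {fst i<..<snd i}) \<le> ?B" if D: "D \<subseteq> C" "finite D" for D
  proof -
    have DK: "c \<le> fst i \<and> fst i < snd i \<and> snd i \<le> d \<and> q * (snd i - fst i) < F (snd i) - F (fst i)"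
      if "i \<in> D" for i using D C(2) that by auto
    have "measure lebesgue (\<Union>i\<in>D. {fst i<..<snd i}) \<le> (\<Sum>i\<in>D. measure lebesgue {fst i<..<snd i})"
      by (rule measure_UNION_le) (use D in auto)
    also have "\<dots> = (\<Sum>i\<in>D. snd i - fst i)"
      by (rule sum.cong) (use DK in force)+
    also have "\<dots> \<le> (\<Sum>i\<in>D. F (snd i) - F (fst i)) / q"
      unfolding sum_divide_distrib by (rule sum_mono) (use DK q in \<open>force simp: field_simps\<close>)
    also have "\<dots> \<le> ?B"
      by (intro divide_right_mono sum_increments_disjoint_intervals_le F)
        (use DK D q cd pairwise_subset[OF C(3)] in auto)
    finally show ?thesis .
  qed
  have U: "(\<Union>i\<in>C. {fst i<..<snd i}) \<in> lmeasurable" "measure lebesgue (\<Union>i\<in>C. {fst i<..<snd i}) \<le> ?B"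
    by (rule fmeasurable_UN_bound[OF C(1) _ fin] measure_UN_bound[OF C(1) _ fin]; simp)+
  let ?N = "E \<inter> {c<..<d} - (\<Union>i\<in>C. {fst i<..<snd i})"
  have N: "?N \<in> lmeasurable" "measure lebesgue ?N = 0"
    using C(4) by (auto simp: negligible_iff_measure)
  show ?thesis
  proof (intro exI conjI)
    show "E \<inter> {c<..<d} \<subseteq> (\<Union>i\<in>C. {fst i<..<snd i}) \<union> ?N" by blast
    show "(\<Union>i\<in>C. {fst i<..<snd i}) \<union> ?N \<in> lmeasurable" using U N by (rule_tac fmeasurable.Un)
    have "measure lebesgue ((\<Union>i\<in>C. {fst i<..<snd i}) \<union> ?N)
        \<le> measure lebesgue (\<Union>i\<in>C. {fst i<..<snd i}) + measure lebesgue ?N"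
      using U N by (intro measure_Un_le) (auto simp: fmeasurableD)
    then show "measure lebesgue ((\<Union>i\<in>C. {fst i<..<snd i}) \<union> ?N) \<le> ?B" using U N by linarith
  qed
qed

text \<open>Lebesgue's comparison of two coverings. Flat intervals are selected inside an open set
  of measure close to the outer measure \<open>m\<close> of \<open>E\<close>; in each of them the
  steep points have outer measure at most \<open>p / q\<close> times its length. So \<open>m\<close>
  is at most \<open>p / q * m\<close> up to an epsilon, and \<open>p < q\<close> forces
  \<open>m = 0\<close>.\<close>

lemma negligible_oscillating_quotients:
  fixes F :: "real \<Rightarrow> real"
  assumes F: "mono F" and pq: "0 \<le> p" "p < q" and "bounded E"
    and flat: "\<And>t e. \<lbrakk>t \<in> E; 0 < e\<rbrakk> \<Longrightarrow>
      \<exists>a b. a < t \<and> t < b \<and> b - a < e \<and> F b - F a < p * (b - a)"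
    and steep: "\<And>t e. \<lbrakk>t \<in> E; 0 < e\<rbrakk> \<Longrightarrow>
      \<exists>a b. a < t \<and> t < b \<and> b - a < e \<and> q * (b - a) < F b - F a"
  shows "negligible E"
proof -
  let ?\<mu> = "measure lebesgue"
  define \<M> where "\<M> = {V. E \<subseteq> V \<and> V \<in> lmeasurable}"
  define m where "m = Inf (?\<mu> ` \<M>)"
  have q: "0 < q" using pq by simp
  obtain B where "E \<subseteq> ball 0 B" using bounded_subset_ballD[OF \<open>bounded E\<close>, of 0] by metis
  then have "ball 0 B \<in> \<M>" unfolding \<M>_def by (simp add: lmeasurable_ball)
  then have ne: "\<M> \<noteq> {}" by auto
  have bdd: "bdd_below (?\<mu> ` \<M>)" by (rule bdd_belowI[of _ 0]) auto
  have m0: "0 \<le> m" unfolding m_def using ne by (intro cInf_greatest) auto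
  have small: "\<exists>V. E \<subseteq> V \<and> V \<in> lmeasurable \<and> ?\<mu> V < r" if "m < r" for r
    using cInf_lessD[of "?\<mu> ` \<M>" r] ne that unfolding m_def by (auto simp: \<M>_def)
  \<comment> \<open>One \<open>e\<close> pays for approximating the outer measure by a measurable
    \<open>V\<close>, the other for enlarging \<open>V\<close> to an open \<open>U\<close>.\<close>
  have key: "m \<le> p / q * (m + 2 * e)" if e: "0 < e" for e
  proof -
    obtain V where V: "E \<subseteq> V" "V \<in> lmeasurable" "?\<mu> V < m + e"
      using small[of "m + e"] e by auto
    obtain U where U: "open U" "V \<subseteq> U" "U - V \<in> lmeasurable" "emeasure lebesgue (U - V) < ennreal e"
      by (rule sets_lebesgue_outer_open[OF fmeasurableD[OF V(2)] e])
    have UV: "?\<mu> (U - V) < e"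
      using U(3,4) e by (simp add: emeasure_eq_measure2 fmeasurableD2 emeasure_eq_ennreal_measure ennreal_less_iff)
    have Ulm: "U \<in> lmeasurable"
      using fmeasurable.Un[OF V(2) U(3)] U(2) by (metis Diff_partition)
    have "?\<mu> U \<le> ?\<mu> V + ?\<mu> (U - V)"
      using measure_Un_le[of V lebesgue "U - V"] U V by (metis Diff_partition fmeasurableD)
    then have Um: "?\<mu> U < m + 2 * e" using V UV by linarith
    let ?K = "{(a, b). a < b \<and> {a<..<b} \<subseteq> U \<and> F b - F a < p * (b - a)}"
    have cov: "\<exists>a b. (a, b) \<in> ?K \<and> a < t \<and> t < b \<and> b - a < d" if t: "t \<in> E" "0 < d" for t d
    proof -
      obtain r where r: "0 < r" "ball t r \<subseteq> U" using U(1,2) V(1) t openE by blast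
      have "0 < min d r" using r t by simp
      then obtain a b where ab: "a < t" "t < b" "b - a < min d r" "F b - F a < p * (b - a)"
        using flat[OF t(1)] by blast
      have "{a<..<b} \<subseteq> ball t r" using ab by (auto simp: dist_real_def)
      then show ?thesis using ab r by (intro exI[of _ a] exI[of _ b]) auto
    qed
    obtain C where C: "countable C" "C \<subseteq> ?K"
      "pairwise (\<lambda>i j. disjnt {fst i<..<snd i} {fst j<..<snd j}) C"
      "negligible (E - (\<Union>i\<in>C. {fst i<..<snd i}))"
      by (rule Vitali_covering_intervals[of E ?K, OF cov])
    have CK: "fst i < snd i" "{fst i<..<snd i} \<subseteq> U" "F (snd i) - F (fst i) < p * (snd i - fst i)"
      if "i \<in> C" for i using subsetD[OF C(2) that] by (auto simp: case_prod_beta)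
    have "\<forall>i\<in>C. \<exists>W. E \<inter> {fst i<..<snd i} \<subseteq> W \<and> W \<in> lmeasurable
        \<and> ?\<mu> W \<le> (F (snd i) - F (fst i)) / q"
      using outer_cover_of_steep_points[OF F q CK(1) steep] by blast
    from bchoice[OF this] obtain W where "\<forall>i\<in>C. E \<inter> {fst i<..<snd i} \<subseteq> W i \<and> W i \<in> lmeasurable
        \<and> ?\<mu> (W i) \<le> (F (snd i) - F (fst i)) / q" ..
    then have W: "\<And>i. i \<in> C \<Longrightarrow> E \<inter> {fst i<..<snd i} \<subseteq> W i"
      "\<And>i. i \<in> C \<Longrightarrow> W i \<in> lmeasurable" "\<And>i. i \<in> C \<Longrightarrow> ?\<mu> (W i) \<le> (F (snd i) - F (fst i)) / q"
      by auto
    have fin: "?\<mu> (\<Union>i\<in>D. W i) \<le> p / q * ?\<mu> U" if D: "D \<subseteq> C" "finite D" for D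
    proof -
      have "?\<mu> (\<Union>i\<in>D. W i) \<le> (\<Sum>i\<in>D. ?\<mu> (W i))"
        by (rule measure_UNION_le) (use D W in \<open>auto simp: fmeasurableD\<close>)
      also have "\<dots> \<le> (\<Sum>i\<in>D. p / q * ?\<mu> {fst i<..<snd i})"
      proof (rule sum_mono)
        fix i assume "i \<in> D"
        then have "i \<in> C" using D by auto
        have "?\<mu> (W i) \<le> (F (snd i) - F (fst i)) / q" using W(3) \<open>i \<in> C\<close> .
        also have "\<dots> \<le> p * (snd i - fst i) / q"
          using CK(3)[OF \<open>i \<in> C\<close>] q by (intro divide_right_mono) auto
        finally show "?\<mu> (W i) \<le> p / q * ?\<mu> {fst i<..<snd i}" using CK(1)[OF \<open>i \<in> C\<close>] by simp
      qed
      also have "\<dots> = p / q * ?\<mu> (\<Union>i\<in>D. {fst i<..<snd i})"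
        unfolding sum_distrib_left[symmetric]
        by (subst measure_UNION')
          (use D in \<open>auto intro: pairwise_subset[OF C(3)] simp: fmeasurableD\<close>)
      also have "\<dots> \<le> p / q * ?\<mu> U"
        using CK(2) D pq q Ulm
        by (intro mult_left_mono measure_mono_fmeasurable) (auto intro!: sets.finite_UN)
      finally show ?thesis .
    qed
    have W': "(\<Union>i\<in>C. W i) \<in> lmeasurable" "?\<mu> (\<Union>i\<in>C. W i) \<le> p / q * ?\<mu> U"
      by (rule fmeasurable_UN_bound[OF C(1) W(2) fin] measure_UN_bound[OF C(1) W(2) fin]; assumption)+
    let ?N = "E - (\<Union>i\<in>C. {fst i<..<snd i})"
    have N: "?N \<in> lmeasurable" "?\<mu> ?N = 0"
      using C(4) by (auto simp: negligible_iff_measure)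
    have "(\<Union>i\<in>C. W i) \<union> ?N \<in> \<M>"
      unfolding \<M>_def using W(1) fmeasurable.Un[OF W'(1) N(1)] by blast
    then have "m \<le> ?\<mu> ((\<Union>i\<in>C. W i) \<union> ?N)"
      unfolding m_def using bdd by (intro cInf_lower) auto
    also have "\<dots> \<le> ?\<mu> (\<Union>i\<in>C. W i) + ?\<mu> ?N"
      using W' N by (intro measure_Un_le) (auto simp: fmeasurableD)
    also have "\<dots> \<le> p / q * ?\<mu> U" using W' N by simp
    also have "\<dots> \<le> p / q * (m + 2 * e)" using Um pq by (intro mult_left_mono) auto
    finally show ?thesis .
  qed
  have "m \<le> p / q * m"
  proof (rule field_le_epsilon)
    fix e :: real assume e: "0 < e"
    have "m \<le> p / q * (m + 2 * (e / 2))" using key[of "e/2"] e by simp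
    also have "\<dots> = p / q * m + p / q * e" by (simp add: algebra_simps add_divide_distrib)
    also have "p / q * e \<le> 1 * e" using e pq by (intro mult_right_mono) auto
    finally show "m \<le> p / q * m + e" by simp
  qed
  then have "(1 - p / q) * m \<le> 0" by (simp add: algebra_simps)
  moreover have "0 < 1 - p / q" using pq by simp
  ultimately have "m = 0" using m0 by (auto simp: mult_le_0_iff)
  show ?thesis
    unfolding negligible_outer_le
  proof (intro allI impI)
    fix e :: real assume "0 < e"
    then show "\<exists>T. E \<subseteq> T \<and> T \<in> lmeasurable \<and> ?\<mu> T \<le> e"
      using small[of e] \<open>m = 0\<close> by (auto intro: less_imp_le)
  qed
qed

text \<open>A difference quotient at \<open>t\<close> has \<open>t\<close> as an endpoint, whereas a
  Vitali covering needs \<open>t\<close> in the interior. The inequality is strict and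
  \<open>F\<close> continuous, so this endpoint can be pushed slightly past
  \<open>t\<close>.\<close>

lemma open_interval_of_quotient_less:
  fixes F :: "real \<Rightarrow> real"
  assumes F: "continuous_on UNIV F" and fr: "\<exists>\<^sub>F s in at t. (F s - F t) / (s - t) < p" and e: "0 < e"
  shows "\<exists>a b. a < t \<and> t < b \<and> b - a < e \<and> F b - F a < p * (b - a)"
proof -
  have cont: "isCont F u" for u using F by (simp add: continuous_on_eq_continuous_at)
  have "\<forall>\<^sub>F s in at t. dist s t < e / 2 \<and> s \<noteq> t"
    using e by (intro eventually_conj eventually_at_ball'[of _ t UNIV, simplified])
      (auto simp: eventually_at intro!: exI[of _ "e / 2"])
  then obtain s where s: "(F s - F t) / (s - t) < p" "dist s t < e / 2" "s \<noteq> t"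
    using frequently_eventually_frequently[OF fr] by (auto dest!: frequently_ex)
  show ?thesis
  proof (cases "t < s")
    case True
    have c: "isCont (\<lambda>u. F s - F u - p * (s - u)) t" using cont by (intro continuous_intros) auto
    have "F s - F t - p * (s - t) < 0" using s True by (simp add: field_simps)
    then have "\<forall>\<^sub>F u in at_left t. F s - F u - p * (s - u) < 0"
      by (rule order_tendstoD(2)[OF tendsto_within_subset[OF isContD[OF c] subset_UNIV]])
    moreover have "\<forall>\<^sub>F u in at_left t. t - e / 2 < u \<and> u < t"
      using eventually_at_left_real[of "t - e / 2" t] e by simp
    ultimately have "\<forall>\<^sub>F u in at_left t. F s - F u - p * (s - u) < 0 \<and> t - e / 2 < u \<and> u < t"
      by (rule eventually_conj)
    then obtain u where "F s - F u - p * (s - u) < 0" "t - e / 2 < u" "u < t"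
      using eventually_happens'[of "at_left t"] by auto
    then show ?thesis using s True by (intro exI[of _ u] exI[of _ s]) (auto simp: dist_real_def)
  next
    case False
    then have st: "s < t" using s by simp
    have c: "isCont (\<lambda>u. F u - F s - p * (u - s)) t" using cont by (intro continuous_intros) auto
    have "F t - F s - p * (t - s) < 0" using s st by (simp add: field_simps)
    then have "\<forall>\<^sub>F u in at_right t. F u - F s - p * (u - s) < 0"
      by (rule order_tendstoD(2)[OF tendsto_within_subset[OF isContD[OF c] subset_UNIV]])
    moreover have "\<forall>\<^sub>F u in at_right t. t < u \<and> u < t + e / 2"
      using eventually_at_right_real[of t "t + e / 2"] e by simp
    ultimately have "\<forall>\<^sub>F u in at_right t. F u - F s - p * (u - s) < 0 \<and> t < u \<and> u < t + e / 2"
      by (rule eventually_conj)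
    then obtain u where "F u - F s - p * (u - s) < 0" "u < t + e / 2" "t < u"
      using eventually_happens'[of "at_right t"] by auto
    then show ?thesis using s st by (intro exI[of _ s] exI[of _ u]) (auto simp: dist_real_def)
  qed
qed

text \<open>\<open>l\<close> and \<open>u\<close> are the lower and upper limits; the bound
  \<open>L\<close> makes them finite, and equality would produce a limit.\<close>

lemma oscillation_if_no_limit:
  fixes f :: "'b \<Rightarrow> real"
  assumes F: "F \<noteq> bot" and bnd: "\<And>x. \<bar>f x\<bar> \<le> L" and nolim: "\<nexists>c. (f \<longlongrightarrow> c) F"
  shows "\<exists>l u. l < u \<and> (\<forall>p. l < p \<longrightarrow> p < u \<longrightarrow> (\<exists>\<^sub>F x in F. f x < p) \<and> (\<exists>\<^sub>F x in F. p < f x))"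
proof -
  let ?l = "Liminf F (\<lambda>x. ereal (f x))" and ?u = "Limsup F (\<lambda>x. ereal (f x))"
  have le: "?l \<le> ?u" by (rule Liminf_le_Limsup[OF F])
  have l0: "ereal (- L) \<le> ?l"
  proof (rule Liminf_bounded)
    show "\<forall>\<^sub>F x in F. ereal (- L) \<le> ereal (f x)"
      using bnd by (intro always_eventually allI) (simp add: abs_le_iff minus_le_iff)
  qed
  have uL: "?u \<le> ereal L"
  proof (rule Limsup_bounded)
    show "\<forall>\<^sub>F x in F. ereal (f x) \<le> ereal L"
      using bnd by (intro always_eventually allI) (simp add: abs_le_iff)
  qed
  have "\<bar>?l\<bar> \<noteq> \<infinity>" "\<bar>?u\<bar> \<noteq> \<infinity>" using l0 uL le by auto
  then obtain l u where l: "?l = ereal l" and u: "?u = ereal u" using ereal_real' by metis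
  have "l \<noteq> u"
  proof
    assume "l = u"
    then have "((\<lambda>x. ereal (f x)) \<longlongrightarrow> ereal l) F"
      by (intro Liminf_eq_Limsup F l) (simp add: u)
    then show False using nolim by auto
  qed
  then have lu: "l < u" using le l u by simp
  have "(\<exists>\<^sub>F x in F. f x < p) \<and> (\<exists>\<^sub>F x in F. p < f x)" if p: "l < p" "p < u" for p
  proof -
    have "\<exists>\<^sub>F x in F. f x < p"
    proof (rule ccontr)
      assume "\<not> ?thesis"
      then have "\<forall>\<^sub>F x in F. ereal p \<le> ereal (f x)"
        by (simp add: not_frequently not_less)
      from Liminf_bounded[OF this] show False using p l by simp
    qed
    moreover have "\<exists>\<^sub>F x in F. p < f x"
    proof (rule ccontr)
      assume "\<not> ?thesis"
      then have "\<forall>\<^sub>F x in F. ereal (f x) \<le> ereal p"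
        by (simp add: not_frequently not_less)
      from Limsup_bounded[OF this] show False using p u by simp
    qed
    ultimately show ?thesis ..
  qed
  then show ?thesis using lu by blast
qed

text \<open>Where differentiability fails, two rationals \<open>p < q\<close> fit strictly between
  the lower and the upper derivative. The exceptional set is thus covered by countably many
  negligible sets \<open>E p q n\<close>, with \<open>n\<close> making each of them bounded.\<close>

lemma mono_lipschitz_differentiable_ae:
  fixes F :: "real \<Rightarrow> real"
  assumes mono: "mono F" and lip: "L-lipschitz_on UNIV F"
  shows "negligible {t. \<not> F differentiable (at t)}"
proof -
  define Q where "Q t s = (F s - F t) / (s - t)" for t s
  have cont: "continuous_on UNIV F" "continuous_on UNIV (\<lambda>t. - F t)"
    using lipschitz_on_continuous_on[OF lip] by (auto intro: continuous_on_minus)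
  define E where "E p q n = {t. norm t \<le> real n \<and>
    (\<exists>\<^sub>F s in at t. Q t s < p) \<and> (\<exists>\<^sub>F s in at t. Q t s > q)}" for p q n
  have negE: "negligible (E p q n)" if pq: "0 \<le> p" "p < q" for p q n
  proof (rule negligible_oscillating_quotients[OF mono pq])
    show "bounded (E p q n)" by (rule boundedI[of _ "real n"]) (auto simp: E_def)
    fix t e :: real assume t: "t \<in> E p q n" "0 < e"
    show "\<exists>a b. a < t \<and> t < b \<and> b - a < e \<and> F b - F a < p * (b - a)"
      using open_interval_of_quotient_less[OF cont(1)] t by (auto simp: E_def Q_def)
    \<comment> \<open>Steep quotients of \<open>F\<close> are flat quotients of \<open>- F\<close>,
      so one lemma supplies both kinds of intervals.\<close>
    have "(- F s - - F t) / (s - t) = - Q t s" for s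
      unfolding Q_def by (simp add: minus_divide_left)
    then have "\<exists>\<^sub>F s in at t. (- F s - - F t) / (s - t) < - q"
      using t(1) by (simp add: E_def)
    from open_interval_of_quotient_less[OF cont(2) this t(2)]
    show "\<exists>a b. a < t \<and> t < b \<and> b - a < e \<and> q * (b - a) < F b - F a"
      by (auto simp: algebra_simps)
  qed
  let ?I = "{(p, q, n). 0 \<le> p \<and> p < q} :: (rat \<times> rat \<times> nat) set"
  have "{t. \<not> F differentiable (at t)} \<subseteq> (\<Union>(p, q, n)\<in>?I. E (real_of_rat p) (real_of_rat q) n)"
  proof
    fix t assume "t \<in> {t. \<not> F differentiable (at t)}"
    then have nd: "\<not> F differentiable (at t)" by simp
    have Q0: "0 \<le> Q t s" for s
      using monoD[OF mono, of s t] monoD[OF mono, of t s] unfolding Q_def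
      by (cases "s \<le> t") (auto simp: divide_nonpos_nonpos)
    have QL: "\<bar>Q t s\<bar> \<le> \<bar>L\<bar>" for s
    proof -
      have "\<bar>F s - F t\<bar> \<le> \<bar>L\<bar> * \<bar>s - t\<bar>"
        using lipschitz_onD[OF lip, of s t] lipschitz_on_nonneg[OF lip] by (simp add: dist_real_def)
      then show ?thesis unfolding Q_def by (auto simp: abs_divide divide_le_eq)
    qed
    have nolim: "\<nexists>c. (Q t \<longlongrightarrow> c) (at t)"
      using nd real_differentiable_def unfolding has_field_derivative_iff Q_def by blast
    obtain l u where lu: "l < u"
      "\<forall>p. l < p \<longrightarrow> p < u \<longrightarrow> (\<exists>\<^sub>F s in at t. Q t s < p) \<and> (\<exists>\<^sub>F s in at t. p < Q t s)"
      using oscillation_if_no_limit[OF at_neq_bot QL nolim] by blast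
    obtain p where p: "l < real_of_rat p" "real_of_rat p < u" using of_rat_dense[OF lu(1)] by auto
    obtain q where q: "real_of_rat p < real_of_rat q" "real_of_rat q < u" using of_rat_dense[OF p(2)] by auto
    have freq: "\<exists>\<^sub>F s in at t. Q t s < real_of_rat p" "\<exists>\<^sub>F s in at t. real_of_rat q < Q t s"
      using lu(2)[rule_format, of "real_of_rat p"] lu(2)[rule_format, of "real_of_rat q"] p q by auto
    then obtain s where "Q t s < real_of_rat p" by (auto dest: frequently_ex)
    then have "0 < real_of_rat p" using Q0[of s] by linarith
    then have "0 \<le> p" "p < q" using q by (auto simp: of_rat_less)
    moreover obtain n where "norm t \<le> real n" using real_arch_simple by blast
    moreover note freq
    ultimately show "t \<in> (\<Union>(p, q, n)\<in>?I. E (real_of_rat p) (real_of_rat q) n)"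
      by (auto simp: E_def intro!: bexI[of _ "(p, q, n)"])
  qed
  moreover have "negligible (\<Union>(p, q, n)\<in>?I. E (real_of_rat p) (real_of_rat q) n)"
    by (rule negligible_countable_Union) (auto intro!: negE simp: of_rat_less countable_Collect)
  ultimately show ?thesis by (rule negligible_subset[rotated])
qed

text \<open>Adding \<open>L * t\<close> makes \<open>F\<close> nondecreasing and does not affect
  differentiability.\<close>

lemma lipschitz_real_differentiable_ae:
  fixes F :: "real \<Rightarrow> real"
  assumes lip: "L-lipschitz_on UNIV F"
  shows "negligible {t. \<not> F differentiable (at t)}"
proof -
  have L: "\<bar>F s - F t\<bar> \<le> L * \<bar>s - t\<bar>" for s t
    using lipschitz_onD[OF lip, of s t] by (simp add: dist_real_def)
  let ?F = "\<lambda>t. F t + L * t"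
  have "mono ?F"
  proof (rule monoI)
    fix s t :: real assume "s \<le> t"
    then show "?F s \<le> ?F t" using L[of t s] by (simp add: algebra_simps abs_le_iff)
  qed
  moreover have "(L + L)-lipschitz_on UNIV ?F"
    by (rule lipschitz_on_add[OF lip])
      (auto intro!: lipschitz_onI simp: dist_real_def abs_mult lipschitz_on_nonneg[OF lip] simp flip: right_diff_distrib)
  ultimately have "negligible {t. \<not> ?F differentiable (at t)}"
    by (rule mono_lipschitz_differentiable_ae)
  moreover have "F differentiable (at t)" if "?F differentiable (at t)" for t
  proof -
    have "(\<lambda>s. ?F s - L * s) differentiable (at t)"
      by (intro derivative_intros that)
    then show ?thesis by simp
  qed
  ultimately show ?thesis by (auto elim!: negligible_subset)
qed

lemma lipschitz_differentiable_ae: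
  fixes F :: "real \<Rightarrow> 'a::euclidean_space"
  assumes lip: "L-lipschitz_on UNIV F"
  shows "negligible {t. \<not> F differentiable (at t)}"
proof -
  have "negligible {t. \<not> (\<lambda>s. F s \<bullet> b) differentiable (at t)}" if "b \<in> Basis" for b
  proof (rule lipschitz_real_differentiable_ae)
    show "L-lipschitz_on UNIV (\<lambda>s. F s \<bullet> b)"
    proof (rule lipschitz_onI[OF _ lipschitz_on_nonneg[OF lip]])
      fix s t
      have "dist (F s \<bullet> b) (F t \<bullet> b) \<le> norm (F s - F t)"
        using Basis_le_norm[OF that, of "F s - F t"] by (simp add: dist_real_def inner_diff_left)
      also have "\<dots> \<le> L * dist s t" using lipschitz_onD[OF lip, of s t] by (simp add: dist_norm)
      finally show "dist (F s \<bullet> b) (F t \<bullet> b) \<le> L * dist s t" .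
    qed
  qed
  then have "negligible (\<Union>b\<in>Basis. {t. \<not> (\<lambda>s. F s \<bullet> b) differentiable (at t)})"
    by (intro negligible_Union) auto
  then show ?thesis
    by (rule negligible_subset) (auto simp: differentiable_componentwise_within[of F])
qed

section \<open>Integrals of derivatives of Lipschitz functions\<close>

text \<open>The difference quotients of \<open>F\<close> are bounded by \<open>L\<close> and
  converge to \<open>F'\<close> almost everywhere, so dominated convergence applies. Their integrals
  are explicit: with an antiderivative \<open>I\<close> of \<open>F\<close> they are differences of
  difference quotients of \<open>I\<close> at \<open>b\<close> and at \<open>a\<close>, whose limits
  are \<open>F b\<close> and \<open>F a\<close>.\<close>

lemma lipschitz_has_integral_derivative:
  fixes F :: "real \<Rightarrow> real"
  assumes lip: "L-lipschitz_on UNIV F" and "a \<le> b" and N: "negligible N"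
    and der: "\<And>t. t \<in> {a..b} - N \<Longrightarrow> (F has_real_derivative F' t) (at t)"
  shows "(F' has_integral (F b - F a)) {a..b}"
proof -
  have cont: "continuous_on S F" for S
    using lipschitz_on_continuous_on[OF lip] continuous_on_subset by blast
  \<comment> \<open>The margins leave room for shifts by \<open>h n \<le> 1\<close> and make the
    derivative of \<open>I\<close> two-sided on the range that is used.\<close>
  obtain I where I: "\<And>x. x \<in> {a - 1..b + 2} \<Longrightarrow> (I has_vector_derivative F x) (at x within {a - 1..b + 2})"
    using antiderivative_continuous[OF cont] by metis
  have I': "(I has_real_derivative F x) (at x)" if "a \<le> x" "x \<le> b + 1" for x
  proof -
    have "x \<in> interior {a - 1..b + 2}" using that by simp
    then have "at x within {a - 1..b + 2} = at x" by (rule at_within_interior)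
    then show ?thesis using I[of x] that by (simp add: has_real_derivative_iff_has_vector_derivative)
  qed
  define h where "h n = inverse (real (Suc n))" for n
  have h: "0 < h n" "h n \<le> 1" for n by (auto simp: h_def inverse_le_1_iff)
  have h0: "h \<longlonglongrightarrow> 0" unfolding h_def by (rule LIMSEQ_inverse_real_of_nat)
  have h0': "filterlim h (at 0) sequentially"
    using h0 h(1) by (auto simp: filterlim_at intro!: always_eventually) (metis less_irrefl)
  define G where "G n t = (F (t + h n) - F t) / h n" for n t
  have G: "(G n has_integral ((I (b + h n) - I b) / h n - (I (a + h n) - I a) / h n)) {a..b}" for n
  proof -
    have "((\<lambda>t. (I (t + h n) - I t) / h n) has_vector_derivative G n t) (at t within {a..b})"
      if "t \<in> {a..b}" for t
    proof -
      have "((\<lambda>t. (I (t + h n) - I t) / h n) has_real_derivative G n t) (at t)"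
        unfolding G_def
        by (rule derivative_eq_intros DERIV_shift[THEN iffD1] I' refl | use that h[of n] in simp)+
      then show ?thesis
        by (metis has_field_derivative_at_within has_real_derivative_iff_has_vector_derivative)
    qed
    from fundamental_theorem_of_calculus[OF \<open>a \<le> b\<close> this] show ?thesis by simp
  qed
  have Iq: "(\<lambda>n. (I (x + h n) - I x) / h n) \<longlonglongrightarrow> F x" if "a \<le> x" "x \<le> b" for x
  proof -
    have "((\<lambda>u. (I (x + u) - I x) / u) \<longlongrightarrow> F x) (at 0)"
      using I'[of x] that by (simp add: DERIV_def)
    from filterlim_compose[OF this h0'] show ?thesis .
  qed
  \<comment> \<open>Quotients and limit are set to 0 on \<open>N\<close>, so that convergence holds
    at every point of the interval.\<close>
  define G' where "G' t = (if t \<in> N then 0 else F' t)" for t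
  define Gn where "Gn n t = (if t \<in> N then 0 else G n t)" for n t
  have int_Gn: "(Gn n has_integral ((I (b + h n) - I b) / h n - (I (a + h n) - I a) / h n)) {a..b}" for n
    by (rule has_integral_spike[OF N _ G]) (auto simp: Gn_def)
  have dct: "G' integrable_on {a..b} \<and> (\<lambda>n. integral {a..b} (Gn n)) \<longlonglongrightarrow> integral {a..b} G'"
  proof (rule conjI)
    have bnd: "norm (Gn n t) \<le> L" for n t
    proof -
      have "\<bar>F (t + h n) - F t\<bar> \<le> L * h n"
        using lipschitz_onD[OF lip, of "t + h n" t] h(1)[of n] by (simp add: dist_real_def)
      then have "norm (G n t) \<le> L" using h(1)[of n] by (simp add: G_def field_simps)
      then show ?thesis using lipschitz_on_nonneg[OF lip] by (auto simp: Gn_def)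
    qed
    have lim: "(\<lambda>n. Gn n t) \<longlonglongrightarrow> G' t" if "t \<in> {a..b}" for t
    proof (cases "t \<in> N")
      case False
      have "((\<lambda>u. (F (t + u) - F t) / u) \<longlongrightarrow> F' t) (at 0)"
        using der[of t] that False by (simp add: DERIV_def)
      from filterlim_compose[OF this h0'] show ?thesis using False by (simp add: Gn_def G'_def G_def)
    qed (simp add: Gn_def G'_def)
    have dc: "\<And>n. Gn n integrable_on {a..b}" "(\<lambda>_. L) integrable_on {a..b}"
      using int_Gn by (auto simp: integrable_on_def)
    show "G' integrable_on {a..b}"
      by (rule dominated_convergence(1)[where f = Gn, OF dc(1) dc(2)]) (use bnd lim in auto)
    show "(\<lambda>n. integral {a..b} (Gn n)) \<longlonglongrightarrow> integral {a..b} G'"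
      by (rule dominated_convergence(2)[where f = Gn, OF dc(1) dc(2)]) (use bnd lim in auto)
  qed
  have "(\<lambda>n. integral {a..b} (Gn n)) \<longlonglongrightarrow> F b - F a"
    unfolding integral_unique[OF int_Gn] using \<open>a \<le> b\<close> by (intro tendsto_diff Iq) auto
  then have "integral {a..b} G' = F b - F a" using LIMSEQ_unique conjunct2[OF dct] by metis
  then have "(G' has_integral (F b - F a)) {a..b}" using integrable_integral[of G' "{a..b}"] dct by simp
  then show ?thesis
    by (rule has_integral_spike[OF N, rotated]) (auto simp: G'_def)
qed

lemma negligible_nonzero_if_integral_0:
  fixes f :: "'b::euclidean_space \<Rightarrow> real"
  assumes int: "(f has_integral 0) S" and nonneg: "\<And>x. x \<in> S \<Longrightarrow> 0 \<le> f x"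
  shows "negligible {x \<in> S. f x \<noteq> 0}"
proof -
  have "f absolutely_integrable_on S"
    by (rule nonnegative_absolutely_integrable_1) (use assms in \<open>auto simp: integrable_on_def\<close>)
  then have F: "integrable lebesgue (\<lambda>x. indicator S x *\<^sub>R f x)"
    and "(\<integral>x. indicator S x *\<^sub>R f x \<partial>lebesgue) = 0"
    using set_lebesgue_integral_eq_integral(2)[of S f] integral_unique[OF int]
    by (auto simp: set_integrable_def set_lebesgue_integral_def)
  then have "AE x in lebesgue. indicator S x *\<^sub>R f x = 0"
    using nonneg by (subst (asm) integral_nonneg_eq_0_iff_AE) (auto simp: indicator_def)
  then obtain N where N: "N \<in> null_sets lebesgue" "{x. \<not> indicator S x *\<^sub>R f x = 0} \<subseteq> N"
    by (auto simp: eventually_ae_filter)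
  have "negligible N" using N(1) by (simp only: negligible_iff_null_sets)
  moreover have "{x \<in> S. f x \<noteq> 0} \<subseteq> N"
    using N(2) by (auto simp: subset_iff)
  ultimately show ?thesis by (rule negligible_subset)
qed

lemma lipschitz_imp_abs_cont_01:
  assumes lip: "K-lipschitz_on UNIV \<gamma>"
  shows "abs_cont_01 \<gamma>"
  unfolding abs_cont_01_def
proof (intro allI impI)
  fix \<epsilon> :: real assume \<epsilon>: "0 < \<epsilon>"
  have K: "0 \<le> K" using lipschitz_on_nonneg[OF lip] .
  show "\<exists>\<delta>>0. \<forall>S :: (real \<times> real) set.
        finite S \<longrightarrow> (\<forall>(a,b)\<in>S. 0 \<le> a \<and> a < b \<and> b \<le> 1) \<longrightarrow>
        (\<forall>(a,b)\<in>S. \<forall>(c,d)\<in>S. (a,b) \<noteq> (c,d) \<longrightarrow> {a<..<b} \<inter> {c<..<d} = {}) \<longrightarrow>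
        (\<Sum>(a,b)\<in>S. b - a) < \<delta> \<longrightarrow> (\<Sum>(a,b)\<in>S. norm (\<gamma> b - \<gamma> a)) < \<epsilon>"
  proof (intro exI[of _ "\<epsilon> / (K + 1)"] conjI allI impI)
    show "0 < \<epsilon> / (K + 1)" using \<epsilon> K by simp
    fix S :: "(real \<times> real) set"
    assume S: "\<forall>(a,b)\<in>S. 0 \<le> a \<and> a < b \<and> b \<le> 1" "(\<Sum>(a,b)\<in>S. b - a) < \<epsilon> / (K + 1)"
    have "(\<Sum>(a,b)\<in>S. norm (\<gamma> b - \<gamma> a)) \<le> (\<Sum>(a,b)\<in>S. K * (b - a))"
    proof (rule sum_mono, clarify)
      fix a b assume "(a, b) \<in> S"
      then show "norm (\<gamma> b - \<gamma> a) \<le> K * (b - a)"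
        using S(1) lipschitz_onD[OF lip, of b a] by (force simp: dist_norm)
    qed
    also have "\<dots> = K * (\<Sum>(a,b)\<in>S. b - a)" by (simp add: sum_distrib_left case_prod_beta)
    also have "\<dots> \<le> K * (\<epsilon> / (K + 1))" using S(2) K by (intro mult_left_mono) auto
    also have "\<dots> < \<epsilon>" using \<epsilon> K by (simp add: field_simps)
    finally show "(\<Sum>(a,b)\<in>S. norm (\<gamma> b - \<gamma> a)) < \<epsilon>" .
  qed
qed

section \<open>Limit curves of Euler iterations\<close>

lemma strict_mono_choice:
  assumes "\<And>n N. \<exists>i\<ge>N. P n (i::nat)"
  shows "\<exists>r::nat \<Rightarrow> nat. strict_mono r \<and> (\<forall>n. P n (r n))"
proof -
  have "\<exists>r. \<forall>n. P n (r n) \<and> r n < r (Suc n)"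
  proof (rule dependent_nat_choice)
    show "\<exists>i. P 0 i" using assms by blast
    show "\<exists>j. P (Suc n) j \<and> i < j" for i n using assms[of "Suc i" "Suc n"] by (auto simp: Suc_le_eq)
  qed
  then show ?thesis by (auto simp: strict_mono_Suc_iff)
qed

lemma has_vector_derivative_imp_quotient:
  assumes "(\<gamma> has_vector_derivative u) (at t)"
  shows "((\<lambda>s. (\<gamma> s - \<gamma> t) /\<^sub>R (s - t)) \<longlongrightarrow> u) (at t)"
proof -
  have "((\<lambda>s. (\<gamma> s - \<gamma> t - (s - t) *\<^sub>R u) /\<^sub>R norm (s - t)) \<longlongrightarrow> 0) (at t)"
    using assms by (simp add: has_vector_derivative_def has_derivative_at_within has_derivative_within)
  then have "((\<lambda>s. norm ((\<gamma> s - \<gamma> t - (s - t) *\<^sub>R u) /\<^sub>R norm (s - t))) \<longlongrightarrow> 0) (at t)"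
    by (rule tendsto_norm_zero)
  moreover have "\<forall>\<^sub>F s in at t. norm ((\<gamma> s - \<gamma> t - (s - t) *\<^sub>R u) /\<^sub>R norm (s - t))
      = norm ((\<gamma> s - \<gamma> t) /\<^sub>R (s - t) - u)"
  proof (rule eventually_at_filter[THEN iffD2, OF always_eventually], intro allI impI)
    fix s assume "s \<noteq> t"
    then have "(\<gamma> s - \<gamma> t) /\<^sub>R (s - t) - u = (\<gamma> s - \<gamma> t - (s - t) *\<^sub>R u) /\<^sub>R (s - t)"
      by (simp add: scaleR_diff_right)
    then show "norm ((\<gamma> s - \<gamma> t - (s - t) *\<^sub>R u) /\<^sub>R norm (s - t)) = norm ((\<gamma> s - \<gamma> t) /\<^sub>R (s - t) - u)"
      by simp
  qed
  ultimately have "((\<lambda>s. norm ((\<gamma> s - \<gamma> t) /\<^sub>R (s - t) - u)) \<longlongrightarrow> 0) (at t)"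
    by (rule Lim_transform_eventually)
  then show ?thesis using LIM_zero_iff tendsto_norm_zero_iff by blast
qed

text \<open>The velocity \<open>v k\<close> need not lie in \<open>G (z k)\<close>; only limits of
  velocities along convergent subsequences must belong to \<open>G\<close>. This asymptotic form
  absorbs the inexact solves of the algorithm and still forces limit curves into the
  inclusion.\<close>

locale euler_iteration =
  fixes z v :: "nat \<Rightarrow> 'a::euclidean_space" and \<eta> :: "nat \<Rightarrow> real" and V B :: real
    and G :: "'a \<Rightarrow> 'a set"
  assumes step: "\<And>k. z (Suc k) = z k - \<eta> k *\<^sub>R v k"
    and v_bound: "\<And>k. norm (v k) \<le> V"
    and z_bound: "\<And>k. norm (z k) \<le> B"
    and eta_nonneg: "\<And>k. 0 \<le> \<eta> k"
    and eta_lim: "\<eta> \<longlonglongrightarrow> 0"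
    and eta_not_summable: "\<not> summable \<eta>"
    and G_convex: "\<And>p. convex (G p)"
    and G_closed: "\<And>p. closed (G p)"
    and G_limit: "\<And>r p u. \<lbrakk>strict_mono r; (\<lambda>j. z (r j)) \<longlonglongrightarrow> p; (\<lambda>j. v (r j)) \<longlonglongrightarrow> u\<rbrakk> \<Longrightarrow> u \<in> G p"
begin

definition time :: "nat \<Rightarrow> real" where "time k = (\<Sum>i<k. \<eta> i)"

text \<open>\<open>pass i s\<close> is the time a clock running from \<open>0\<close> to \<open>s\<close> spends in step \<open>i\<close>.\<close>
definition pass :: "nat \<Rightarrow> real \<Rightarrow> real" where "pass i s = min s (time (Suc i)) - min s (time i)"

text \<open>Piecewise linear interpolation of the first \<open>N\<close> steps, constant afterwards.\<close>
definition interp :: "nat \<Rightarrow> real \<Rightarrow> 'a" where "interp N s = z 0 - (\<Sum>i<N. pass i s *\<^sub>R v i)"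

lemma V_nonneg: "0 \<le> V"
  using v_bound[of 0] norm_ge_zero order_trans by blast

lemma time_0 [simp]: "time 0 = 0" and time_Suc: "time (Suc k) = time k + \<eta> k"
  by (auto simp: time_def)

lemma time_mono: "i \<le> j \<Longrightarrow> time i \<le> time j"
  by (rule lift_Suc_mono_le[of time]) (auto simp: time_Suc eta_nonneg)

lemma less_of_time_less: "time i < time j \<Longrightarrow> i < j"
  using time_mono not_le by (meson leD)

lemma time_unbounded: "\<exists>N. C < time N"
proof (rule ccontr)
  assume "\<not> ?thesis"
  then have "\<And>n. (\<Sum>i<n. \<eta> i) \<le> C" by (auto simp: time_def not_less)
  then have "summable \<eta>" by (rule summableI_nonneg_bounded[OF eta_nonneg])
  then show False using eta_not_summable by simp
qed

lemma exists_node: 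
  assumes "0 \<le> s"
  obtains i where "time i \<le> s" "s < time (Suc i)"
proof -
  let ?P = "\<lambda>N. s < time N"
  have ex: "?P (LEAST N. ?P N)" using time_unbounded[of s] by (auto intro: LeastI_ex)
  then obtain i where i: "(LEAST N. ?P N) = Suc i"
    using assms by (cases "LEAST N. ?P N") auto
  have "\<not> ?P i" by (rule not_less_Least) (simp add: i)
  then show thesis using that[of i] ex i by auto
qed

lemma z_eq_sum: "z k = z 0 - (\<Sum>i<k. \<eta> i *\<^sub>R v i)"
  by (induction k) (auto simp: step)

lemma pass_mono: "s \<le> s' \<Longrightarrow> pass i s \<le> pass i s'"
  using eta_nonneg[of i] by (auto simp: pass_def time_Suc min_def)

lemma sum_pass: "0 \<le> s \<Longrightarrow> (\<Sum>i<N. pass i s) = min s (time N)"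
  by (induction N) (auto simp: pass_def)

lemma interp_diff: "interp N s - interp N s' = (\<Sum>i<N. (pass i s' - pass i s) *\<^sub>R v i)"
  by (simp add: interp_def scaleR_diff_left sum_subtractf)

lemma interp_time:
  assumes "k \<le> N" shows "interp N (time k) = z k"
proof -
  have "(\<Sum>i<N. pass i (time k) *\<^sub>R v i) = (\<Sum>i<k. \<eta> i *\<^sub>R v i)"
  proof (rule sum.mono_neutral_cong_right)
    show "\<forall>i\<in>{..<N} - {..<k}. pass i (time k) *\<^sub>R v i = 0"
      using time_mono[of k] by (auto simp: pass_def min_def dest: le_SucI)
    show "pass i (time k) *\<^sub>R v i = \<eta> i *\<^sub>R v i" if "i \<in> {..<k}" for i
      using time_mono[of "Suc i" k] time_mono[of i k] that by (auto simp: pass_def time_Suc min_def)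
  qed (use assms in auto)
  then show ?thesis by (simp add: interp_def z_eq_sum[of k])
qed

lemma interp_lipschitz:
  assumes "0 \<le> s" "0 \<le> s'" shows "norm (interp N s - interp N s') \<le> V * \<bar>s - s'\<bar>"
  using assms
proof (induction s s' rule: linorder_wlog)
  case (le s s')
  have "norm (interp N s - interp N s') \<le> (\<Sum>i<N. (pass i s' - pass i s) * V)"
    unfolding interp_diff
  proof (rule sum_norm_le)
    fix i
    show "norm ((pass i s' - pass i s) *\<^sub>R v i) \<le> (pass i s' - pass i s) * V"
      using pass_mono[OF le(1), of i] v_bound[of i] by (simp add: mult_left_mono)
  qed
  also have "\<dots> = (min s' (time N) - min s (time N)) * V"
    using le by (simp add: sum_distrib_right[symmetric] sum_subtractf sum_pass)
  also have "\<dots> \<le> \<bar>s - s'\<bar> * V"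
    using V_nonneg le by (intro mult_right_mono) (auto simp: min_def)
  finally show ?case by (simp add: mult.commute)
next
  case (sym s s')
  then show ?case by (simp add: norm_minus_commute abs_minus_commute)
qed

section \<open>Velocities of limit curves\<close>

text \<open>Upper semicontinuity tested on a single half-space: violating indices with
  \<open>z i\<close> tending to \<open>p\<close> would have bounded velocities, and a limit of these
  would be a member of \<open>G p\<close> outside the half-space.\<close>

lemma halfspace_near:
  assumes "\<And>u. u \<in> G p \<Longrightarrow> b < a \<bullet> u"
  shows "\<exists>e>0. \<exists>K. \<forall>i\<ge>K. norm (z i - p) < e \<longrightarrow> b < a \<bullet> v i"
proof (rule ccontr)
  assume no: "\<not> ?thesis"
  have "\<exists>i\<ge>N. norm (z i - p) < inverse (real (Suc n)) \<and> a \<bullet> v i \<le> b" for n N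
    using no by (metis inverse_positive_iff_positive not_le of_nat_0_less_iff zero_less_Suc)
  then obtain r where r: "strict_mono r"
      "\<And>n. norm (z (r n) - p) < inverse (real (Suc n)) \<and> a \<bullet> v (r n) \<le> b"
    using strict_mono_choice[of "\<lambda>n i. norm (z i - p) < inverse (real (Suc n)) \<and> a \<bullet> v i \<le> b"] by blast
  have "(\<lambda>n. z (r n) - p) \<longlonglongrightarrow> 0"
    by (rule Lim_null_comparison[OF _ LIMSEQ_inverse_real_of_nat])
      (use r(2) in \<open>auto intro!: always_eventually less_imp_le\<close>)
  then have zr: "(\<lambda>n. z (r n)) \<longlonglongrightarrow> p" by (simp add: LIM_zero_iff)
  have "bounded (range (\<lambda>n. v (r n)))" by (rule boundedI[of _ V]) (auto simp: v_bound)
  then obtain u f where f: "strict_mono f" "((\<lambda>n. v (r n)) \<circ> f) \<longlonglongrightarrow> u"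
    using bounded_imp_convergent_subsequence by blast
  then have vrf: "(\<lambda>n. v ((r \<circ> f) n)) \<longlonglongrightarrow> u" by (simp add: o_def)
  have "u \<in> G p"
    using LIMSEQ_subseq_LIMSEQ[OF zr f(1)] vrf
    by (intro G_limit[of "r \<circ> f"] strict_mono_o r f) (auto simp: o_def)
  moreover have "a \<bullet> u \<le> b"
    by (rule LIMSEQ_le_const2[OF tendsto_inner[OF tendsto_const vrf]]) (use r(2) in auto)
  ultimately show False using assms by force
qed

text \<open>The displacement is a sum of velocities weighted by the time spent in each step. The
  weights are nonnegative, add up to \<open>s' - s\<close>, and vanish for steps that do not overlap
  the window; \<open>s - \<eta> i < time i\<close> says that step \<open>i\<close> ends after
  \<open>s\<close>.\<close>

lemma average_in_halfspace:
  assumes near: "\<And>i. \<lbrakk>i < N; s - \<eta> i < time i; time i < s'\<rbrakk> \<Longrightarrow> b \<le> a \<bullet> v i"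
    and s: "0 \<le> s" "s \<le> s'" "s' \<le> time N"
  shows "b * (s' - s) \<le> a \<bullet> (interp N s - interp N s')"
proof -
  have "(pass i s' - pass i s) * b \<le> (pass i s' - pass i s) * (a \<bullet> v i)" if "i < N" for i
  proof (cases "s - \<eta> i < time i \<and> time i < s'")
    case True
    then show ?thesis using near that pass_mono[OF s(2), of i] by (intro mult_left_mono) auto
  next
    case False
    then have "pass i s' = pass i s"
      using s eta_nonneg[of i] by (auto simp: pass_def time_Suc min_def)
    then show ?thesis by simp
  qed
  then have "(\<Sum>i<N. (pass i s' - pass i s) * b) \<le> (\<Sum>i<N. (pass i s' - pass i s) * (a \<bullet> v i))"
    by (intro sum_mono) auto
  also have "\<dots> = a \<bullet> (interp N s - interp N s')"
    by (simp add: interp_diff inner_sum_right)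
  finally show ?thesis
    using s unfolding sum_distrib_right[symmetric] by (simp add: sum_subtractf sum_pass min_def mult.commute)
qed
lemma time_nonneg: "0 \<le> time k"
  using time_mono[of 0 k] by simp

text \<open>The nodes \<open>m j\<close> are part of the conclusion because later arguments compare
  the limit curve with values of \<open>h\<close> at actual iterates, not at interpolated
  points.\<close>

lemma limit_curve:
  assumes k: "strict_mono k" and lim: "(\<lambda>j. z (k j)) \<longlonglongrightarrow> p" and T: "0 < T"
  shows "\<exists>\<gamma> r. strict_mono r \<and> V-lipschitz_on UNIV \<gamma> \<and> \<gamma> 0 = p \<and>
    (\<forall>s\<in>{0..T}. \<exists>m. (\<forall>j. time (m j) \<le> time (k (r j)) + s \<and> time (k (r j)) + s < time (Suc (m j)))
        \<and> (\<lambda>j. z (m j)) \<longlonglongrightarrow> \<gamma> s) \<and>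
    (\<forall>t\<in>{0<..<T}. \<forall>u. (\<gamma> has_vector_derivative u) (at t) \<longrightarrow> - u \<in> G (\<gamma> t))"
proof -
  \<comment> \<open>\<open>N j\<close> lies beyond the window of length \<open>T\<close> after step
    \<open>k j\<close>, so the truncation in \<open>interp (N j)\<close> is invisible there.\<close>
  have "\<forall>j. \<exists>n. time (k j) + T < time n" using time_unbounded by blast
  from choice[OF this] obtain N where N: "\<And>j. time (k j) + T < time (N j)" by blast
  define c where "c j s = interp (N j) (time (k j) + s)" for j s
  have c_lip: "norm (c j s - c j s') \<le> V * \<bar>s - s'\<bar>" if "0 \<le> s" "0 \<le> s'" for j s s'
    using interp_lipschitz[of "time (k j) + s" "time (k j) + s'" "N j"] that time_nonneg[of "k j"]
    by (simp add: c_def)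
  have kN: "k j \<le> N j" for j
    using less_of_time_less[of "k j" "N j"] N[of j] T by simp
  have c0: "c j 0 = z (k j)" for j by (simp add: c_def interp_time kN)
  have c_bound: "norm (c j s) \<le> B + V * T" if "s \<in> {0..T}" for j s
  proof -
    have "norm (c j s) \<le> norm (z (k j)) + norm (c j s - c j 0)"
      by (metis add.commute c0 diff_add_cancel norm_triangle_ineq)
    also have "\<dots> \<le> B + V * s" using c_lip[of s 0 j] z_bound[of "k j"] that by auto
    also have "\<dots> \<le> B + V * T" using that V_nonneg by (auto intro: mult_left_mono)
    finally show ?thesis .
  qed
  have equi: "\<exists>d. 0 < d \<and> (\<forall>n y. y \<in> {0..T} \<and> norm (x - y) < d \<longrightarrow> norm (c n x - c n y) < e)"
    if x: "x \<in> {0..T}" "0 < e" for x e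
  proof (intro exI[of _ "e / (V + 1)"] conjI allI impI)
    show "0 < e / (V + 1)" using x V_nonneg by simp
    fix n y assume y: "y \<in> {0..T} \<and> norm (x - y) < e / (V + 1)"
    have "norm (c n x - c n y) \<le> V * \<bar>x - y\<bar>" using c_lip x y by auto
    also have "\<dots> \<le> V * (e / (V + 1))" using y V_nonneg by (intro mult_left_mono) auto
    also have "\<dots> < e" using x V_nonneg by (simp add: field_simps)
    finally show "norm (c n x - c n y) < e" .
  qed
  have "\<exists>g r. strict_mono (r :: nat \<Rightarrow> nat) \<and>
    (\<forall>e>0. \<exists>N. \<forall>n x. n \<ge> N \<and> x \<in> {0..T} \<longrightarrow> norm (c (r n) x - g x) < e)"
  proof (rule Arzela_Ascoli[of "{0..T}" c "B + V * T"])
    fix g and r :: "nat \<Rightarrow> nat"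
    assume "strict_mono r"
      "\<And>e. 0 < e \<Longrightarrow> \<exists>N. \<forall>n x. n \<ge> N \<and> x \<in> {0..T} \<longrightarrow> norm (c (r n) x - g x) < e"
    then show ?thesis by blast
  qed (use c_bound equi in auto)
  then obtain g r where r: "strict_mono (r :: nat \<Rightarrow> nat)"
    and g: "\<forall>e>0. \<exists>N. \<forall>n x. n \<ge> N \<and> x \<in> {0..T} \<longrightarrow> norm (c (r n) x - g x) < e"
    by blast
  have conv: "(\<lambda>j. c (r j) s) \<longlonglongrightarrow> g s" if "s \<in> {0..T}" for s
    unfolding LIMSEQ_iff using g that by blast
  have g_lip: "norm (g s - g s') \<le> V * \<bar>s - s'\<bar>" if "s \<in> {0..T}" "s' \<in> {0..T}" for s s'
    by (rule LIMSEQ_le_const2[OF tendsto_norm[OF tendsto_diff[OF conv conv]]])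
      (use that c_lip in auto)
  \<comment> \<open>Clamping extends the uniform limit from \<open>{0..T}\<close> to a Lipschitz
    curve on the whole line.\<close>
  define \<gamma> where "\<gamma> s = g (max 0 (min T s))" for s
  have \<gamma>_eq: "\<gamma> s = g s" if "s \<in> {0..T}" for s using that by (simp add: \<gamma>_def)
  have \<gamma>_lip: "V-lipschitz_on UNIV \<gamma>"
  proof (rule lipschitz_onI[OF _ V_nonneg])
    fix s s'
    have "dist (\<gamma> s) (\<gamma> s') \<le> V * \<bar>max 0 (min T s) - max 0 (min T s')\<bar>"
      unfolding \<gamma>_def dist_norm using T by (intro g_lip) auto
    also have "\<dots> \<le> V * dist s s'"
      using V_nonneg by (intro mult_left_mono) (auto simp: dist_real_def)
    finally show "dist (\<gamma> s) (\<gamma> s') \<le> V * dist s s'" .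
  qed
  have \<gamma>0: "\<gamma> 0 = p"
  proof -
    have "(\<lambda>j. z (k (r j))) \<longlonglongrightarrow> g 0" using conv[of 0] T by (simp add: c0)
    moreover have "(\<lambda>j. z (k (r j))) \<longlonglongrightarrow> p"
      using LIMSEQ_subseq_LIMSEQ[OF lim r] by (simp add: o_def)
    ultimately show ?thesis using LIMSEQ_unique T by (simp add: \<gamma>_eq) blast
  qed
  have kr: "j \<le> k (r j)" for j using strict_mono_imp_increasing[OF strict_mono_o[OF k r], of j] by simp
  have nodes: "\<exists>m. (\<forall>j. time (m j) \<le> time (k (r j)) + s \<and> time (k (r j)) + s < time (Suc (m j)))
        \<and> (\<lambda>j. z (m j)) \<longlonglongrightarrow> \<gamma> s" if s: "s \<in> {0..T}" for s
  proof -
    have "\<exists>m. time m \<le> time (k (r j)) + s \<and> time (k (r j)) + s < time (Suc m)" for j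
      using exists_node[of "time (k (r j)) + s"] time_nonneg[of "k (r j)"] s by auto
    then obtain m where m: "\<And>j. time (m j) \<le> time (k (r j)) + s" "\<And>j. time (k (r j)) + s < time (Suc (m j))"
      by metis
    have mk: "j \<le> m j" for j
      using less_of_time_less[of "k (r j)" "Suc (m j)"] m(2)[of j] s kr[of j] by auto
    have mN: "m j \<le> N (r j)" for j
      using less_of_time_less[of "m j" "N (r j)"] m(1)[of j] N[of "r j"] s by auto
    have "(\<lambda>j. \<eta> (m j)) \<longlonglongrightarrow> 0"
      by (rule filterlim_compose[OF eta_lim filterlim_at_top_mono[OF filterlim_ident]])
        (auto intro: always_eventually mk)
    then have "(\<lambda>j. V * \<eta> (m j)) \<longlonglongrightarrow> 0" by (rule tendsto_mult_right_zero)
    moreover have "norm (z (m j) - c (r j) s) \<le> V * \<eta> (m j)" for j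
    proof -
      have "norm (z (m j) - c (r j) s) \<le> V * \<bar>time (m j) - (time (k (r j)) + s)\<bar>"
        using interp_lipschitz[of "time (m j)" "time (k (r j)) + s" "N (r j)"] s
          time_nonneg[of "m j"] time_nonneg[of "k (r j)"] by (simp add: c_def interp_time mN)
      also have "\<dots> \<le> V * \<eta> (m j)"
        using m(1)[of j] m(2)[of j] V_nonneg by (intro mult_left_mono) (auto simp: time_Suc)
      finally show ?thesis .
    qed
    ultimately have "(\<lambda>j. z (m j) - c (r j) s) \<longlonglongrightarrow> 0"
      by (rule_tac Lim_null_comparison[rotated]) (auto intro: always_eventually)
    from tendsto_add[OF this conv[OF s]] have "(\<lambda>j. z (m j)) \<longlonglongrightarrow> \<gamma> s"
      by (simp add: \<gamma>_eq[OF s])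
    then show ?thesis using m by blast
  qed
  have deriv: "- u \<in> G (\<gamma> t)" if t: "t \<in> {0<..<T}" and u: "(\<gamma> has_vector_derivative u) (at t)" for t u
  proof (rule ccontr)
    assume "- u \<notin> G (\<gamma> t)"
    then obtain a b where ab: "a \<bullet> - u < b" "\<And>w. w \<in> G (\<gamma> t) \<Longrightarrow> b < a \<bullet> w"
      using separating_hyperplane_closed_point[OF G_convex G_closed] by blast
    obtain e K where e: "0 < e" and K: "\<And>i. \<lbrakk>K \<le> i; norm (z i - \<gamma> t) < e\<rbrakk> \<Longrightarrow> b < a \<bullet> v i"
      using halfspace_near[OF ab(2)] by blast
    \<comment> \<open>During time \<open>h0\<close> a curve drifts by at most \<open>e / 4\<close>;
      together with a distance below \<open>e / 2\<close> between approximating and limit curve this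
      stays below \<open>e\<close>. The bound \<open>T - t\<close> keeps the window inside the
      interval.\<close>
    define h0 where "h0 = min (T - t) (e / (4 * (V + 1)))"
    have h0: "0 < h0" "h0 \<le> T - t" "V * h0 \<le> e / 4"
    proof -
      show "0 < h0" "h0 \<le> T - t" using t e V_nonneg by (auto simp: h0_def)
      have "V * h0 \<le> (V + 1) * (e / (4 * (V + 1)))"
        using V_nonneg \<open>0 < h0\<close> by (intro mult_mono) (auto simp: h0_def)
      also have "\<dots> = e / 4" using V_nonneg by (simp add: field_simps)
      finally show "V * h0 \<le> e / 4" .
    qed
    \<comment> \<open>The step running at the start of a window began before it, but by less than
      its own length; small step sizes keep this node within drift time \<open>h0\<close> as
      well.\<close>
    obtain K1 where K1: "\<And>i. K1 \<le> i \<Longrightarrow> \<eta> i < h0"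
      using order_tendstoD(2)[OF eta_lim h0(1)] by (auto simp: eventually_sequentially)
    have tT: "t \<in> {0..T}" using t by auto
    have ev1: "\<forall>\<^sub>F j in sequentially. norm (c (r j) t - \<gamma> t) < e / 2"
      using tendstoD[OF conv[OF tT], of "e / 2"] e by (simp add: \<gamma>_eq[OF tT] dist_norm)
    have quot: "b * d \<le> a \<bullet> (\<gamma> t - \<gamma> (t + d))" if d: "0 < d" "d < h0" for d
    proof -
      have tdT: "t + d \<in> {0..T}" using t d h0 by auto
      have window: "b * d \<le> a \<bullet> (c (r j) t - c (r j) (t + d))"
        if j: "norm (c (r j) t - \<gamma> t) < e / 2" "K \<le> j" "K1 \<le> j" for j
      proof -
        let ?s = "time (k (r j)) + t" and ?s' = "time (k (r j)) + (t + d)"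
        have "b * (?s' - ?s) \<le> a \<bullet> (interp (N (r j)) ?s - interp (N (r j)) ?s')"
        proof (rule average_in_halfspace)
          fix i assume i: "i < N (r j)" "?s - \<eta> i < time i" "time i < ?s'"
          have "time (k (r j)) < time (Suc i)" using i(2) t by (auto simp: time_Suc)
          then have ki: "j \<le> i" using less_of_time_less[of "k (r j)" "Suc i"] kr[of j] by simp
          have "\<bar>time i - ?s\<bar> \<le> h0" using i d K1[of i] ki j by auto
          then have "V * \<bar>time i - ?s\<bar> \<le> e / 4"
            using h0(3) V_nonneg by (meson mult_left_mono order_trans)
          then have "norm (z i - c (r j) t) \<le> e / 4"
            using interp_lipschitz[of "time i" ?s "N (r j)"] time_nonneg[of i] time_nonneg[of "k (r j)"] t i(1)
            by (simp add: c_def interp_time)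
          moreover have "norm (z i - \<gamma> t) \<le> norm (z i - c (r j) t) + norm (c (r j) t - \<gamma> t)"
            using norm_triangle_ineq[of "z i - c (r j) t" "c (r j) t - \<gamma> t"] by simp
          ultimately have "norm (z i - \<gamma> t) < e" using j(1) e by linarith
          then show "b \<le> a \<bullet> v i" using K[of i] ki j by auto
        qed (use time_nonneg[of "k (r j)"] t d h0 N[of "r j"] in auto)
        then show ?thesis by (simp add: c_def)
      qed
      have "\<forall>\<^sub>F j in sequentially. b * d \<le> a \<bullet> (c (r j) t - c (r j) (t + d))"
        using ev1 eventually_ge_at_top[of K] eventually_ge_at_top[of K1]
        by eventually_elim (rule window)
      moreover have "(\<lambda>j. a \<bullet> (c (r j) t - c (r j) (t + d))) \<longlonglongrightarrow> a \<bullet> (g t - g (t + d))"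
        by (intro tendsto_intros conv tT tdT)
      ultimately show ?thesis
        unfolding \<gamma>_eq[OF tT] \<gamma>_eq[OF tdT] by (blast intro: tendsto_lowerbound[OF _ _ sequentially_bot])
    qed
    have "((\<lambda>s. (\<gamma> s - \<gamma> t) /\<^sub>R (s - t)) \<longlongrightarrow> u) (at_right t)"
      by (rule tendsto_within_subset[OF has_vector_derivative_imp_quotient[OF u] subset_UNIV])
    then have "((\<lambda>s. a \<bullet> - ((\<gamma> s - \<gamma> t) /\<^sub>R (s - t))) \<longlongrightarrow> a \<bullet> - u) (at_right t)"
      by (intro tendsto_intros)
    moreover have "\<forall>\<^sub>F s in at_right t. b \<le> a \<bullet> - ((\<gamma> s - \<gamma> t) /\<^sub>R (s - t))"
    proof -
      have "\<forall>\<^sub>F s in at_right t. s \<in> {t<..<t + h0}" by (rule eventually_at_right_real) (use h0 in simp)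
      then show ?thesis
      proof eventually_elim
        case (elim s)
        have "b * (s - t) \<le> a \<bullet> (\<gamma> t - \<gamma> s)" using quot[of "s - t"] elim by simp
        then have "b \<le> a \<bullet> (\<gamma> t - \<gamma> s) / (s - t)" using elim by (simp add: pos_le_divide_eq)
        also have "\<dots> = a \<bullet> - ((\<gamma> s - \<gamma> t) /\<^sub>R (s - t))"
          unfolding scaleR_minus_right[symmetric] minus_diff_eq by (simp add: divide_inverse mult.commute)
        finally show ?case .
      qed
    qed
    ultimately have "b \<le> a \<bullet> - u" by (rule tendsto_lowerbound) simp
    then show False using ab(1) by simp
  qed
  show ?thesis using r \<gamma>_lip \<gamma>0 nodes deriv by blast
qed

end

section \<open>Lyapunov functions along the iteration\<close>

text \<open>The curves in \<open>h_decreases\<close> are described exactly as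
  \<open>limit_curve\<close> delivers them: Lipschitz, with the inclusion wherever a derivative
  exists. The last condition is of Sard type: every nonempty open interval contains a level that no
  point of \<open>S\<close> attains.\<close>

locale lyapunov_iteration = euler_iteration +
  fixes h :: "'a \<Rightarrow> real" and S :: "'a set"
  assumes h_cont: "continuous_on UNIV h"
    and h_decreases: "\<And>\<gamma> T. \<lbrakk>0 < T; V-lipschitz_on UNIV \<gamma>;
        \<forall>t\<in>{0<..<T}. \<forall>u. (\<gamma> has_vector_derivative u) (at t) \<longrightarrow> - u \<in> G (\<gamma> t); \<gamma> 0 \<notin> S\<rbrakk>
      \<Longrightarrow> h (\<gamma> T) < h (\<gamma> 0)"
    and critical_values: "interior (h ` S) = {}"
begin

lemma h_tendsto: "(z' \<longlongrightarrow> p) F \<Longrightarrow> ((\<lambda>j. h (z' j)) \<longlongrightarrow> h p) F"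
  by (rule continuous_on_tendsto_compose[OF h_cont]) auto

lemma decrease_after_time:
  assumes "strict_mono k" "(\<lambda>j. z (k j)) \<longlonglongrightarrow> p" "0 < T" "p \<notin> S"
  shows "\<exists>r m q. strict_mono r \<and> (\<forall>j. time (m j) \<le> time (k (r j)) + T \<and> k (r j) \<le> m j)
    \<and> (\<lambda>j. z (m j)) \<longlonglongrightarrow> q \<and> h q < h p"
proof -
  from limit_curve[OF assms(1-3)] obtain \<gamma> r where r: "strict_mono r"
    and \<gamma>: "V-lipschitz_on UNIV \<gamma>" "\<gamma> 0 = p"
    and nodes: "\<forall>s\<in>{0..T}. \<exists>m. (\<forall>j. time (m j) \<le> time (k (r j)) + s \<and>
        time (k (r j)) + s < time (Suc (m j))) \<and> (\<lambda>j. z (m j)) \<longlonglongrightarrow> \<gamma> s"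
    and deriv: "\<forall>t\<in>{0<..<T}. \<forall>u. (\<gamma> has_vector_derivative u) (at t) \<longrightarrow> - u \<in> G (\<gamma> t)"
    by blast
  have "T \<in> {0..T}" using \<open>0 < T\<close> by simp
  with nodes obtain m where m: "\<forall>j. time (m j) \<le> time (k (r j)) + T \<and>
        time (k (r j)) + T < time (Suc (m j))" "(\<lambda>j. z (m j)) \<longlonglongrightarrow> \<gamma> T" by blast
  have "k (r j) \<le> m j" for j
    using less_of_time_less[of "k (r j)" "Suc (m j)"] m(1)[rule_format, of j] \<open>0 < T\<close> by simp
  moreover have "h (\<gamma> T) < h p"
    using h_decreases[OF \<open>0 < T\<close> \<gamma>(1) deriv] \<gamma>(2) \<open>p \<notin> S\<close> by simp
  ultimately show ?thesis using r m by blast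
qed

lemma step_vanishes: "(\<lambda>k. z (Suc k) - z k) \<longlonglongrightarrow> 0"
proof (rule Lim_null_comparison)
  show "\<forall>\<^sub>F k in sequentially. norm (z (Suc k) - z k) \<le> \<eta> k * V"
    using v_bound eta_nonneg by (auto simp: step intro!: always_eventually mult_left_mono)
  show "(\<lambda>k. \<eta> k * V) \<longlonglongrightarrow> 0" by (rule tendsto_mult_left_zero[OF eta_lim])
qed

lemma norm_diff_le_time: "i \<le> j \<Longrightarrow> norm (z j - z i) \<le> V * (time j - time i)"
  using interp_lipschitz[of "time j" "time i" j] time_nonneg[of i] time_nonneg[of j] time_mono[of i j]
  by (simp add: interp_time)

lemma upcrossing:
  assumes low: "\<exists>\<^sub>F k in sequentially. h (z k) < c" and high: "\<exists>\<^sub>F k in sequentially. d < h (z k)" and "c < d"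
  shows "\<exists>k\<ge>n. \<exists>m>k. h (z k) \<le> c \<and> d < h (z m) \<and> (\<forall>i. k < i \<and> i \<le> m \<longrightarrow> c < h (z i))"
proof -
  obtain i where i: "n \<le> i" "h (z i) < c"
    using low unfolding frequently_sequentially by blast
  obtain m where m: "i \<le> m" "d < h (z m)"
    using high unfolding frequently_sequentially by blast
  let ?P = "\<lambda>k. k \<le> m \<and> h (z k) \<le> c"
  \<comment> \<open>The last index up to \<open>m\<close> at or below level \<open>c\<close>:
    everything after it stays above \<open>c\<close>, and it is not before \<open>n\<close> because
    \<open>i\<close> is a candidate.\<close>
  define k where "k = (GREATEST k. ?P k)"
  have Pi: "?P i" using i m by simp
  have k: "?P k" unfolding k_def by (rule GreatestI_nat[of ?P i m, OF Pi]) simp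
  have ge: "j \<le> k" if "?P j" for j unfolding k_def by (rule Greatest_le_nat[of ?P j m, OF that]) simp
  have "k \<noteq> m" using k m \<open>c < d\<close> by auto
  then show ?thesis using ge[OF Pi] k i m ge by (intro exI[of _ k] conjI exI[of _ m]) (force simp: not_le)+
qed

lemma h_convergent: "convergent (\<lambda>k. h (z k))"
proof (rule ccontr)
  assume nc: "\<not> ?thesis"
  have unif: "uniformly_continuous_on (cball 0 B) h"
    by (rule compact_uniformly_continuous[OF continuous_on_subset[OF h_cont]]) auto
  have "bounded (h ` cball 0 B)"
    by (rule compact_imp_bounded[OF compact_continuous_image[OF continuous_on_subset[OF h_cont]]]) auto
  then obtain L where "\<forall>y\<in>h ` cball 0 B. norm y \<le> L"
    unfolding bounded_iff by blast
  then have L: "\<bar>h (z k)\<bar> \<le> L" for k using z_bound[of k] by simp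
  have nolim: "\<nexists>c. (\<lambda>k. h (z k)) \<longlonglongrightarrow> c" using nc by (simp add: convergent_def)
  obtain l u where lu: "l < u" "\<forall>p. l < p \<longrightarrow> p < u \<longrightarrow>
      (\<exists>\<^sub>F k in sequentially. h (z k) < p) \<and> (\<exists>\<^sub>F k in sequentially. p < h (z k))"
    using oscillation_if_no_limit[OF sequentially_bot L nolim] by blast
  have "\<not> {l<..<u} \<subseteq> h ` S"
    using critical_values interior_maximal[of "{l<..<u}" "h ` S"] lu(1) by auto
  then obtain c where "c \<in> {l<..<u}" "c \<notin> h ` S" by blast
  then have c: "l < c" "c < u" "c \<notin> h ` S" by simp_all
  \<comment> \<open>Both levels lie strictly between the lower and the upper limit, so the iterates
    pass from below \<open>c\<close> to above \<open>d\<close> infinitely often; the gap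
    \<open>d - c\<close> bounds the duration of such a passage from below.\<close>
  define d where "d = (c + u) / 2"
  have d: "c < d" "l < d" "d < u" using c by (auto simp: d_def)
  define P where "P k m \<longleftrightarrow> h (z k) \<le> c \<and> d < h (z m) \<and> (\<forall>i. k < i \<and> i \<le> m \<longrightarrow> c < h (z i))" for k m
  have "\<exists>k\<ge>n. \<exists>m>k. P k m" for n
    unfolding P_def using upcrossing[of c d n] lu(2) c d by blast
  then obtain r0 where r0: "strict_mono r0" "\<And>n::nat. \<exists>m>r0 n. P (r0 n) m"
    using strict_mono_choice[of "\<lambda>n k. \<exists>m>k. P k m"] by blast
  have "bounded (range (\<lambda>n. z (r0 n)))" by (rule boundedI[of _ B]) (auto simp: z_bound)
  then obtain p f where f: "strict_mono f" "((\<lambda>n. z (r0 n)) \<circ> f) \<longlonglongrightarrow> p"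
    using bounded_imp_convergent_subsequence by blast
  define k where "k = r0 \<circ> f"
  have k: "strict_mono k" unfolding k_def by (rule strict_mono_o[OF r0(1) f(1)])
  have kp: "(\<lambda>j. z (k j)) \<longlonglongrightarrow> p" using f(2) by (simp add: k_def o_def)
  have "\<forall>j. \<exists>m>k j. P (k j) m" using r0(2) by (simp add: k_def)
  from choice[OF this] obtain M where M: "\<And>j. k j < M j" "\<And>j. P (k j) (M j)" by blast
  \<comment> \<open>\<open>z (k j)\<close> lies at or below level \<open>c\<close> and its successor
    above it; as steps vanish, both converge to \<open>p\<close>, which pins the value
    there.\<close>
  have hp: "h p = c"
  proof (rule antisym)
    show "h p \<le> c"
      by (rule LIMSEQ_le_const2[OF h_tendsto[OF kp]]) (use M in \<open>auto simp: P_def\<close>)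
    have "(\<lambda>j. z (Suc (k j)) - z (k j)) \<longlonglongrightarrow> 0"
      using LIMSEQ_subseq_LIMSEQ[OF step_vanishes k] by (simp add: o_def)
    from tendsto_add[OF this kp] have "(\<lambda>j. z (Suc (k j))) \<longlonglongrightarrow> p" by simp
    moreover have "c \<le> h (z (Suc (k j)))" for j using M(1)[of j] M(2)[of j] by (auto simp: P_def)
    ultimately show "c \<le> h p" by (intro LIMSEQ_le_const[OF h_tendsto]) auto
  qed
  then have "p \<notin> S" using c(3) by auto
  have "0 < d - c" using d by simp
  with unif obtain \<delta> where \<delta>: "0 < \<delta>"
    "\<forall>x\<in>cball 0 B. \<forall>y\<in>cball 0 B. dist y x < \<delta> \<longrightarrow> dist (h y) (h x) < d - c"
    unfolding uniformly_continuous_on_def by blast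
  \<comment> \<open>Raising \<open>h\<close> from at most \<open>c\<close> to above \<open>d\<close>
    takes a displacement of at least \<delta>, and speed \<open>V\<close> needs more than time
    \<open>T\<close> for it.\<close>
  define T where "T = \<delta> / (V + 1)"
  have T: "0 < T" "V * T < \<delta>" using \<delta>(1) V_nonneg by (auto simp: T_def field_simps)
  have slow: "time (k j) + T < time (M j)" for j
  proof (rule ccontr)
    assume "\<not> ?thesis"
    then have "V * (time (M j) - time (k j)) \<le> V * T" using V_nonneg by (intro mult_left_mono) auto
    then have "norm (z (M j) - z (k j)) < \<delta>"
      using norm_diff_le_time[of "k j" "M j"] M(1)[of j] T by simp
    then have "dist (h (z (M j))) (h (z (k j))) < d - c"
      by (intro \<delta>(2)[rule_format]) (auto simp: z_bound dist_norm)
    then show False using M(2)[of j] by (auto simp: P_def dist_real_def)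
  qed
  obtain r m q where r: "strict_mono r" "\<And>j. time (m j) \<le> time (k (r j)) + T"
    "\<And>j. k (r j) \<le> m j" "(\<lambda>j. z (m j)) \<longlonglongrightarrow> q" "h q < h p"
    using decrease_after_time[OF k kp T(1) \<open>p \<notin> S\<close>] by blast
  \<comment> \<open>The node reached after time \<open>T\<close> is still inside the upcrossing,
    hence above \<open>c\<close>, unless it is the starting node itself.\<close>
  have lower: "min c (h (z (k (r j)))) \<le> h (z (m j))" for j
  proof (cases "m j = k (r j)")
    case False
    have "m j < M (r j)" using less_of_time_less[of "m j" "M (r j)"] r(2)[of j] slow[of "r j"] by linarith
    then have "c < h (z (m j))" using M(2)[of "r j"] r(3)[of j] False by (auto simp: P_def)
    then show ?thesis by simp
  qed simp
  have "(\<lambda>j. min c (h (z (k (r j))))) \<longlonglongrightarrow> min c (h p)"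
    using LIMSEQ_subseq_LIMSEQ[OF h_tendsto[OF kp] r(1)] by (intro tendsto_min) (auto simp: o_def)
  from LIMSEQ_le[OF this h_tendsto[OF r(4)]] lower have "min c (h p) \<le> h q" by auto
  then show False using hp r(5) by simp
qed

lemma limit_point_in_S:
  assumes k: "strict_mono k" and lim: "(\<lambda>j. z (k j)) \<longlonglongrightarrow> p"
  shows "p \<in> S"
proof (rule ccontr)
  assume "p \<notin> S"
  obtain r m q where r: "strict_mono r" "\<And>j. k (r j) \<le> m j" "(\<lambda>j. z (m j)) \<longlonglongrightarrow> q" "h q < h p"
    using decrease_after_time[OF k lim zero_less_one \<open>p \<notin> S\<close>] by blast
  obtain c where c: "(\<lambda>k. h (z k)) \<longlonglongrightarrow> c" using h_convergent by (auto simp: convergent_def)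
  have mj: "j \<le> m j" for j
    using strict_mono_imp_increasing[OF strict_mono_o[OF k r(1)], of j] r(2)[of j] by simp
  have "h p = c"
    using LIMSEQ_unique[OF h_tendsto[OF lim]] LIMSEQ_subseq_LIMSEQ[OF c k] by (simp add: o_def)
  moreover have "(\<lambda>j. h (z (m j))) \<longlonglongrightarrow> c"
    by (rule filterlim_compose[OF c filterlim_at_top_mono[OF filterlim_ident]])
      (auto intro: always_eventually mj)
  then have "h q = c" using LIMSEQ_unique[OF h_tendsto[OF r(3)]] by simp
  ultimately show False using r(4) by simp
qed

end

section \<open>Second derivatives and matrix bounds\<close>

text \<open>The mean value theorem is applied twice: along \<open>a\<close> to the increment of
  \<phi> over the step \<open>b\<close>, then along \<open>b\<close> to the
  \<open>a\<close>-component of the gradient.\<close>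

lemma second_difference_mean_value:
  fixes \<phi> :: "'a::real_inner \<Rightarrow> real"
  assumes grad: "\<And>y. (\<phi> has_derivative (\<lambda>v. G y \<bullet> v)) (at y)"
    and hess: "\<And>y. (G has_derivative H y) (at y)" and s: "0 < s"
  shows "\<exists>\<xi> \<zeta>. 0 < \<xi> \<and> \<xi> < s \<and> 0 < \<zeta> \<and> \<zeta> < s \<and>
    \<phi> (y + s *\<^sub>R a + s *\<^sub>R b) - \<phi> (y + s *\<^sub>R a) - \<phi> (y + s *\<^sub>R b) + \<phi> y
      = s\<^sup>2 * (H (y + \<xi> *\<^sub>R a + \<zeta> *\<^sub>R b) b \<bullet> a)"
proof -
  have d\<phi>: "((\<lambda>t. \<phi> (p + t *\<^sub>R a)) has_real_derivative G (p + t *\<^sub>R a) \<bullet> a) (at t)" for p t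
  proof -
    have "((\<lambda>t. \<phi> (p + t *\<^sub>R a)) has_derivative (\<lambda>h. G (p + t *\<^sub>R a) \<bullet> (h *\<^sub>R a))) (at t)"
      by (rule has_derivative_compose[OF _ grad]) (auto intro!: derivative_eq_intros)
    then show ?thesis unfolding has_field_derivative_def
      by (rule has_derivative_eq_rhs) (simp add: fun_eq_iff mult.commute)
  qed
  have dG: "((\<lambda>t. G (p + t *\<^sub>R b) \<bullet> a) has_real_derivative H (p + t *\<^sub>R b) b \<bullet> a) (at t)" for p t
  proof -
    have lin: "linear (H (p + t *\<^sub>R b))" using hess has_derivative_linear by blast
    have "((\<lambda>t. G (p + t *\<^sub>R b)) has_derivative (\<lambda>h. H (p + t *\<^sub>R b) (h *\<^sub>R b))) (at t)"
      by (rule has_derivative_compose[OF _ hess]) (auto intro!: derivative_eq_intros)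
    then have "((\<lambda>t. G (p + t *\<^sub>R b) \<bullet> a) has_derivative (\<lambda>h. H (p + t *\<^sub>R b) (h *\<^sub>R b) \<bullet> a)) (at t)"
      by (rule has_derivative_inner_left)
    then show ?thesis unfolding has_field_derivative_def
      by (rule has_derivative_eq_rhs) (simp add: fun_eq_iff mult.commute linear_scale[OF lin])
  qed
  have "((\<lambda>t. \<phi> (y + s *\<^sub>R b + t *\<^sub>R a) - \<phi> (y + t *\<^sub>R a)) has_real_derivative
      G (y + s *\<^sub>R b + t *\<^sub>R a) \<bullet> a - G (y + t *\<^sub>R a) \<bullet> a) (at t)" for t
    by (intro DERIV_diff d\<phi>)
  from MVT2[OF s this] obtain \<xi> where \<xi>: "0 < \<xi>" "\<xi> < s"
    "\<phi> (y + s *\<^sub>R b + s *\<^sub>R a) - \<phi> (y + s *\<^sub>R a) - (\<phi> (y + s *\<^sub>R b) - \<phi> y)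
      = s * (G (y + s *\<^sub>R b + \<xi> *\<^sub>R a) \<bullet> a - G (y + \<xi> *\<^sub>R a) \<bullet> a)" by auto
  from MVT2[OF s dG[of "y + \<xi> *\<^sub>R a"]] obtain \<zeta> where \<zeta>: "0 < \<zeta>" "\<zeta> < s"
    "G (y + \<xi> *\<^sub>R a + s *\<^sub>R b) \<bullet> a - G (y + \<xi> *\<^sub>R a) \<bullet> a = s * (H (y + \<xi> *\<^sub>R a + \<zeta> *\<^sub>R b) b \<bullet> a)" by auto
  show ?thesis
  proof (intro exI conjI)
    have "\<phi> (y + s *\<^sub>R a + s *\<^sub>R b) - \<phi> (y + s *\<^sub>R a) - \<phi> (y + s *\<^sub>R b) + \<phi> y
      = s * (G (y + \<xi> *\<^sub>R a + s *\<^sub>R b) \<bullet> a - G (y + \<xi> *\<^sub>R a) \<bullet> a)"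
      using \<xi>(3) by (simp add: ac_simps)
    then show "\<phi> (y + s *\<^sub>R a + s *\<^sub>R b) - \<phi> (y + s *\<^sub>R a) - \<phi> (y + s *\<^sub>R b) + \<phi> y
      = s\<^sup>2 * (H (y + \<xi> *\<^sub>R a + \<zeta> *\<^sub>R b) b \<bullet> a)" by (simp add: \<zeta>(3) power2_eq_square)
  qed (use \<xi> \<zeta> in auto)
qed

text \<open>The second difference is symmetric in \<open>a\<close> and \<open>b\<close>; divided by
  the squared step it converges to both sides. Symmetry of the Hessian is what later moves its
  inverse across inner products.\<close>

lemma second_derivative_symmetric:
  fixes \<phi> :: "'a::real_inner \<Rightarrow> real"
  assumes grad: "\<And>y. (\<phi> has_derivative (\<lambda>v. G y \<bullet> v)) (at y)"
    and hess: "\<And>y. (G has_derivative H y) (at y)"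
    and cont: "\<And>v. continuous_on UNIV (\<lambda>y. H y v)"
  shows "H y b \<bullet> a = H y a \<bullet> b"
proof -
  define s where "s n = inverse (real (Suc n))" for n
  have s: "0 < s n" for n by (simp add: s_def)
  have s0: "s \<longlonglongrightarrow> 0" unfolding s_def by (rule LIMSEQ_inverse_real_of_nat)
  have lim: "(\<lambda>n. (\<phi> (y + s n *\<^sub>R a + s n *\<^sub>R b) - \<phi> (y + s n *\<^sub>R a) - \<phi> (y + s n *\<^sub>R b) + \<phi> y) / (s n)\<^sup>2)
      \<longlonglongrightarrow> H y b \<bullet> a" for a b
  proof -
    define Q where "Q n \<xi> \<zeta> \<longleftrightarrow> 0 < \<xi> \<and> \<xi> < s n \<and> 0 < \<zeta> \<and> \<zeta> < s n \<and>
      \<phi> (y + s n *\<^sub>R a + s n *\<^sub>R b) - \<phi> (y + s n *\<^sub>R a) - \<phi> (y + s n *\<^sub>R b) + \<phi> y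
        = (s n)\<^sup>2 * (H (y + \<xi> *\<^sub>R a + \<zeta> *\<^sub>R b) b \<bullet> a)" for n \<xi> \<zeta>
    have "\<exists>\<xi> \<zeta>. Q n \<xi> \<zeta>" for n
      unfolding Q_def by (rule second_difference_mean_value[OF grad hess s])
    then obtain \<xi> \<zeta> where "\<And>n. Q n (\<xi> n) (\<zeta> n)" by metis
    then have *: "\<And>n. 0 < \<xi> n \<and> \<xi> n < s n \<and> 0 < \<zeta> n \<and> \<zeta> n < s n \<and>
      \<phi> (y + s n *\<^sub>R a + s n *\<^sub>R b) - \<phi> (y + s n *\<^sub>R a) - \<phi> (y + s n *\<^sub>R b) + \<phi> y
        = (s n)\<^sup>2 * (H (y + \<xi> n *\<^sub>R a + \<zeta> n *\<^sub>R b) b \<bullet> a)"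
      unfolding Q_def .
    have "\<xi> \<longlonglongrightarrow> 0" "\<zeta> \<longlonglongrightarrow> 0"
      by (rule tendsto_sandwich[OF _ _ tendsto_const s0];
          use * in \<open>auto intro!: always_eventually less_imp_le\<close>)+
    then have "(\<lambda>n. y + \<xi> n *\<^sub>R a + \<zeta> n *\<^sub>R b) \<longlonglongrightarrow> y + 0 *\<^sub>R a + 0 *\<^sub>R b"
      by (intro tendsto_intros)
    then have "(\<lambda>n. y + \<xi> n *\<^sub>R a + \<zeta> n *\<^sub>R b) \<longlonglongrightarrow> y" by simp
    then have "(\<lambda>n. H (y + \<xi> n *\<^sub>R a + \<zeta> n *\<^sub>R b) b \<bullet> a) \<longlonglongrightarrow> H y b \<bullet> a"
      by (intro tendsto_inner tendsto_const continuous_on_tendsto_compose[OF cont]) auto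
    moreover have "(\<phi> (y + s n *\<^sub>R a + s n *\<^sub>R b) - \<phi> (y + s n *\<^sub>R a) - \<phi> (y + s n *\<^sub>R b) + \<phi> y) / (s n)\<^sup>2
        = H (y + \<xi> n *\<^sub>R a + \<zeta> n *\<^sub>R b) b \<bullet> a" for n
      using * s[of n] by simp
    ultimately show ?thesis by simp
  qed
  have "(\<lambda>n. (\<phi> (y + s n *\<^sub>R a + s n *\<^sub>R b) - \<phi> (y + s n *\<^sub>R a) - \<phi> (y + s n *\<^sub>R b) + \<phi> y) / (s n)\<^sup>2)
      \<longlonglongrightarrow> H y a \<bullet> b"
    using lim[of b a] by (simp add: algebra_simps)
  from LIMSEQ_unique[OF lim this] show ?thesis .
qed

lemma norm_transpose_mult_le:
  fixes M :: "real^'m^'k"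
  assumes M: "\<And>w. norm (M *v w) \<le> C * norm w" and "0 \<le> C"
  shows "norm (transpose M *v u) \<le> C * norm u"
proof -
  let ?w = "transpose M *v u"
  have "(norm ?w)\<^sup>2 = u \<bullet> (M *v ?w)"
    unfolding power2_norm_eq_inner by (simp add: dot_lmul_matrix)
  also have "\<dots> \<le> norm u * (C * norm ?w)"
    using norm_cauchy_schwarz M by (meson mult_left_mono norm_ge_zero order_trans)
  finally have "norm ?w * norm ?w \<le> (C * norm u) * norm ?w"
    by (simp add: power2_eq_square ac_simps)
  then show ?thesis
    using \<open>0 \<le> C\<close> by (cases "?w = 0") (auto simp: mult_le_cancel_right)
qed

lemma opnorm_bound:
  fixes M :: "real^'m^'k"
  assumes "opnorm M \<le> C" shows "norm (M *v w) \<le> C * norm w"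
  using onorm[of "(*v) M" w] assms mult_right_mono[of "opnorm M" C "norm w"]
  by (simp add: opnorm_def)

lemma norm_derivative_le_lipschitz:
  fixes F :: "'a::real_normed_vector \<Rightarrow> 'b::real_normed_vector"
  assumes der: "(F has_derivative D) (at z)" and lip: "\<And>z'. norm (F z' - F z) \<le> L * norm (z' - z)"
  shows "norm (D w) \<le> L * norm w"
proof -
  have lin: "linear D" using der has_derivative_linear by blast
  have "((\<lambda>t. z + t *\<^sub>R w) has_derivative (\<lambda>t. t *\<^sub>R w)) (at 0)" by (auto intro!: derivative_eq_intros)
  from has_derivative_compose[OF this, of F D] der
  have "((\<lambda>t. F (z + t *\<^sub>R w)) has_vector_derivative D w) (at 0)"
    by (simp add: has_vector_derivative_def linear_scale[OF lin])
  from has_vector_derivative_imp_quotient[OF this]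
  have "((\<lambda>t. (F (z + t *\<^sub>R w) - F z) /\<^sub>R t) \<longlongrightarrow> D w) (at 0)" by simp
  moreover have "\<forall>\<^sub>F t in at 0. norm ((F (z + t *\<^sub>R w) - F z) /\<^sub>R t) \<le> L * norm w"
  proof (rule eventually_at_filter[THEN iffD2, OF always_eventually], intro allI impI)
    fix t :: real assume "t \<noteq> 0"
    have "norm ((F (z + t *\<^sub>R w) - F z) /\<^sub>R t) = norm (F (z + t *\<^sub>R w) - F z) / \<bar>t\<bar>"
      by (simp add: divide_inverse mult.commute)
    also have "\<dots> \<le> L * norm w"
      using \<open>t \<noteq> 0\<close> lip[of "z + t *\<^sub>R w"] by (simp add: pos_divide_le_eq ac_simps)
    finally show "norm ((F (z + t *\<^sub>R w) - F z) /\<^sub>R t) \<le> L * norm w" .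
  qed
  ultimately show ?thesis using Lim_norm_ubound[OF trivial_limit_at] by blast
qed

lemma matrix_tendsto:
  fixes M :: "'b \<Rightarrow> real^'m^'k"
  assumes bnd: "\<And>j w. norm (M j *v w) \<le> C * norm w"
    and diff: "\<And>j w. norm ((M j - M0) *v w) \<le> e j * norm w"
    and e: "(e \<longlongrightarrow> 0) F" and w: "(w \<longlongrightarrow> w0) F"
  shows "((\<lambda>j. M j *v w j) \<longlongrightarrow> M0 *v w0) F"
proof (rule Lim_null[THEN iffD2], rule Lim_null_comparison, intro always_eventually allI)
  fix j
  have "M j *v w j - M0 *v w0 = M j *v (w j - w0) + (M j - M0) *v w0"
    by (simp add: matrix_vector_mult_diff_distrib matrix_vector_mult_diff_rdistrib)
  then show "norm (M j *v w j - M0 *v w0) \<le> C * norm (w j - w0) + e j * norm w0"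
    using norm_triangle_ineq[of "M j *v (w j - w0)" "(M j - M0) *v w0"] bnd[of j "w j - w0"] diff[of j w0]
    by simp
next
  have "((\<lambda>j. norm (w j - w0)) \<longlongrightarrow> 0) F" using w by (auto intro!: tendsto_norm_zero simp: LIM_zero_iff)
  then have "((\<lambda>j. C * norm (w j - w0) + e j * norm w0) \<longlongrightarrow> C * 0 + 0 * norm w0) F"
    using e by (intro tendsto_intros)
  then show "((\<lambda>j. C * norm (w j - w0) + e j * norm w0) \<longlongrightarrow> 0) F" by simp
qed

section \<open>The lower-level problem\<close>

locale lower_level =
  fixes gy :: "(real^'n) \<times> (real^'p) \<Rightarrow> real^'p"
    and Hxy :: "(real^'n) \<times> (real^'p) \<Rightarrow> real^'p^'n"
    and Hyy :: "(real^'n) \<times> (real^'p) \<Rightarrow> real^'p^'p"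
    and \<mu> Lg Qg :: real
  assumes \<mu>_pos: "0 < \<mu>" and Lg_pos: "0 < Lg" and Qg_pos: "0 < Qg"
    and gy_deriv: "\<And>z. (gy has_derivative (\<lambda>(u, v). u v* Hxy z + Hyy z *v v)) (at z)"
    and gy_lip: "\<And>z z'. norm (gy z' - gy z) \<le> Lg * norm (z' - z)"
    and Hyy_pd: "\<And>z v. v \<bullet> (Hyy z *v v) \<ge> \<mu> * (norm v)\<^sup>2"
    and Hyy_sym: "\<And>z a b. (Hyy z *v b) \<bullet> a = (Hyy z *v a) \<bullet> b"
    and Hyy_lip: "\<And>z z'. opnorm (Hyy z - Hyy z') \<le> Qg * dist z z'"
    and Hxy_lip: "\<And>z z'. opnorm (Hxy z - Hxy z') \<le> Qg * dist z z'"
begin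

definition Hinv :: "(real^'n) \<times> (real^'p) \<Rightarrow> real^'p \<Rightarrow> real^'p"
  where "Hinv z w = matrix_inv (Hyy z) *v w"

lemma norm_Hyy_ge: "\<mu> * norm v \<le> norm (Hyy z *v v)"
proof (cases "v = 0")
  case False
  have "\<mu> * norm v * norm v \<le> norm (Hyy z *v v) * norm v"
    using Hyy_pd[of v z] norm_cauchy_schwarz[of v "Hyy z *v v"] by (simp add: power2_eq_square ac_simps)
  then show ?thesis using False by (simp add: mult_le_cancel_right)
qed simp

lemma invertible_Hyy: "invertible (Hyy z)"
proof -
  have "inj ((*v) (Hyy z))"
  proof (rule injI)
    fix v w assume "Hyy z *v v = Hyy z *v w"
    then have "\<mu> * norm (v - w) \<le> 0"
      using norm_Hyy_ge[of "v - w" z] by (simp add: matrix_vector_mult_diff_distrib)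
    then show "v = w" using \<mu>_pos by (simp add: mult_le_0_iff)
  qed
  then show ?thesis
    by (simp add: invertible_left_inverse matrix_left_invertible_injective)
qed

lemma Hyy_Hinv [simp]: "Hyy z *v Hinv z w = w" and Hinv_Hyy [simp]: "Hinv z (Hyy z *v w) = w"
proof -
  have "Hyy z ** matrix_inv (Hyy z) = mat 1 \<and> matrix_inv (Hyy z) ** Hyy z = mat 1"
    using invertible_Hyy[of z] unfolding invertible_def matrix_inv_def by (rule someI_ex)
  then show "Hyy z *v Hinv z w = w" "Hinv z (Hyy z *v w) = w"
    by (simp_all add: Hinv_def matrix_vector_mul_assoc)
qed

lemma linear_Hinv: "linear (Hinv z)"
  unfolding Hinv_def by (rule matrix_vector_mul_linear)

lemma bounded_linear_Hinv: "bounded_linear (Hinv z)"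
  using linear_Hinv by (simp add: linear_conv_bounded_linear)

lemma norm_le_Hyy: "norm v \<le> norm (Hyy z *v v) / \<mu>"
  using norm_Hyy_ge[of v z] \<mu>_pos by (simp add: field_simps)

lemma norm_Hinv: "norm (Hinv z w) \<le> norm w / \<mu>"
  using norm_le_Hyy[of "Hinv z w" z] by simp

lemma Hinv_sym: "Hinv z a \<bullet> b = a \<bullet> Hinv z b"
  using Hyy_sym[of z "Hinv z b" "Hinv z a"] by (simp add: inner_commute)

lemma norm_gy_deriv: "norm (u v* Hxy z + Hyy z *v v) \<le> Lg * norm (u, v)"
  using norm_derivative_le_lipschitz[OF gy_deriv[of z] gy_lip, of "(u, v)"] by simp

text \<open>In direction \<open>(u, 0)\<close> the derivative of \<open>gy\<close> is this vector,
  so the Lipschitz constant bounds it. The bound for \<open>Hxy\<close> itself then follows by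
  duality.\<close>

lemma norm_transpose_Hxy: "norm (transpose (Hxy z) *v u) \<le> Lg * norm u"
  using norm_gy_deriv[of u z 0] by simp

lemma norm_Hxy: "norm (Hxy z *v w) \<le> Lg * norm w"
  using norm_transpose_mult_le[of "transpose (Hxy z)" Lg w] norm_transpose_Hxy Lg_pos
  by (simp add: transpose_transpose)

text \<open>This permits replacing \<open>1 + Lg / \<mu>\<close> by \<open>2 * (Lg / \<mu>)\<close>,
  one source of the factor 4 in the second bound on \<beta>.\<close>

lemma \<mu>_le_Lg: "\<mu> \<le> Lg"
proof -
  obtain v :: "real^'p" where v: "norm v = 1" using vector_choose_size[of 1] by auto
  have "\<mu> * norm v \<le> Lg * norm v"
    using norm_Hyy_ge[of v undefined] norm_gy_deriv[of 0 undefined v] by simp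
  then show ?thesis by (simp add: v)
qed

lemma Hyy_diff_bound: "norm ((Hyy z' - Hyy z) *v w) \<le> Qg * norm (z' - z) * norm w"
  using opnorm_bound[OF Hyy_lip, of z' z w] by (simp add: dist_norm)

lemma Hxy_diff_bound: "norm ((Hxy z' - Hxy z) *v w) \<le> Qg * norm (z' - z) * norm w"
  using opnorm_bound[OF Hxy_lip, of z' z w] by (simp add: dist_norm)

lemma transpose_Hxy_diff_bound:
  "norm (transpose (Hxy z' - Hxy z) *v u) \<le> Qg * norm (z' - z) * norm u"
  by (rule norm_transpose_mult_le[OF Hxy_diff_bound]) (use Qg_pos in simp)

lemma gy_tendsto: "(z \<longlongrightarrow> z0) F \<Longrightarrow> ((\<lambda>j. gy (z j)) \<longlongrightarrow> gy z0) F"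
  by (rule isCont_tendsto_compose[OF has_derivative_continuous[OF gy_deriv]])

text \<open>Applying \<open>Hyy (z j)\<close> to the difference of the two solutions leaves the
  difference of the right-hand sides and a variation of the Hessian; coercivity turns this into a
  bound.\<close>

lemma Hinv_tendsto:
  assumes z: "(z \<longlongrightarrow> z0) F" and w: "(w \<longlongrightarrow> w0) F"
  shows "((\<lambda>j. Hinv (z j) (w j)) \<longlongrightarrow> Hinv z0 w0) F"
proof (rule Lim_null[THEN iffD2], rule Lim_null_comparison, intro always_eventually allI)
  fix j
  have "Hyy (z j) *v (Hinv (z j) (w j) - Hinv z0 w0) = (w j - w0) - (Hyy (z j) - Hyy z0) *v Hinv z0 w0"
    by (simp add: matrix_vector_mult_diff_distrib matrix_vector_mult_diff_rdistrib)
  then have "norm (Hinv (z j) (w j) - Hinv z0 w0)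
      \<le> norm ((w j - w0) - (Hyy (z j) - Hyy z0) *v Hinv z0 w0) / \<mu>"
    using norm_le_Hyy[of "Hinv (z j) (w j) - Hinv z0 w0" "z j"] by simp
  also have "\<dots> \<le> (norm (w j - w0) + Qg * norm (z j - z0) * norm (Hinv z0 w0)) / \<mu>"
    using \<mu>_pos norm_triangle_ineq4[of "w j - w0" "(Hyy (z j) - Hyy z0) *v Hinv z0 w0"]
      Hyy_diff_bound[of "z j" z0 "Hinv z0 w0"]
    by (intro divide_right_mono) linarith+
  finally show "norm (Hinv (z j) (w j) - Hinv z0 w0)
      \<le> (norm (w j - w0) + Qg * norm (z j - z0) * norm (Hinv z0 w0)) / \<mu>" .
next
  have "((\<lambda>j. norm (w j - w0)) \<longlongrightarrow> 0) F" "((\<lambda>j. norm (z j - z0)) \<longlongrightarrow> 0) F"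
    using w z by (auto intro!: tendsto_norm_zero simp: LIM_zero_iff)
  then have "((\<lambda>j. (norm (w j - w0) + Qg * norm (z j - z0) * norm (Hinv z0 w0)) / \<mu>)
      \<longlongrightarrow> (0 + Qg * 0 * norm (Hinv z0 w0)) / \<mu>) F"
    using \<mu>_pos by (intro tendsto_intros) auto
  then show "((\<lambda>j. (norm (w j - w0) + Qg * norm (z j - z0) * norm (Hinv z0 w0)) / \<mu>) \<longlongrightarrow> 0) F" by simp
qed

lemma Qg_dist_tendsto: "(z \<longlongrightarrow> z0) F \<Longrightarrow> ((\<lambda>j. Qg * norm (z j - z0)) \<longlongrightarrow> 0) F"
  by (intro tendsto_mult_right_zero tendsto_norm_zero) (simp add: LIM_zero_iff)

lemma Hxy_tendsto:
  assumes "(z \<longlongrightarrow> z0) F" "(w \<longlongrightarrow> w0) F"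
  shows "((\<lambda>j. Hxy (z j) *v w j) \<longlongrightarrow> Hxy z0 *v w0) F"
  by (rule matrix_tendsto[OF norm_Hxy Hxy_diff_bound Qg_dist_tendsto[OF assms(1)] assms(2)])

lemma transpose_Hxy_tendsto:
  assumes "(z \<longlongrightarrow> z0) F" "(u \<longlongrightarrow> u0) F"
  shows "((\<lambda>j. transpose (Hxy (z j)) *v u j) \<longlongrightarrow> transpose (Hxy z0) *v u0) F"
proof (rule matrix_tendsto[OF norm_transpose_Hxy _ Qg_dist_tendsto[OF assms(1)] assms(2)])
  have "transpose (A - B) = transpose A - transpose B" for A B :: "real^'p^'n"
    by (simp add: transpose_def vec_eq_iff)
  then show "norm ((transpose (Hxy (z j)) - transpose (Hxy z0)) *v w) \<le> Qg * norm (z j - z0) * norm w" for j w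
    using transpose_Hxy_diff_bound[of "z j" z0 w] by metis
qed

section \<open>The Newton correction\<close>

text \<open>The correction in \<open>y\<close> for the equation \<open>gy = 0\<close>; the vectors
  \<open>w\<close> of the algorithm approximate it.\<close>

definition newton :: "(real^'n) \<times> (real^'p) \<Rightarrow> real^'p" where "newton z = Hinv z (gy z)"

lemma Amap_eq: "Amap Hyy gy z = snd z - newton z"
  by (simp add: Amap_def newton_def Hinv_def)

lemma newton_tendsto: "(z \<longlongrightarrow> z0) F \<Longrightarrow> ((\<lambda>j. newton (z j)) \<longlongrightarrow> newton z0) F"
  unfolding newton_def by (intro Hinv_tendsto gy_tendsto)

lemma norm_newton: "norm (newton z) \<le> norm (gy z) / \<mu>"
  unfolding newton_def by (rule norm_Hinv)

text \<open>An exact identity instead of a Taylor expansion: applying \<open>Hyy z\<close> leaves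
  only the variation of the Hessian acting on \<open>newton z'\<close>. The error is therefore
  proportional to the correction, hence controlled by \<open>gy\<close>.\<close>

lemma newton_diff_bound:
  "norm (newton z' - newton z - Hinv z (gy z' - gy z)) \<le> Qg / \<mu> * norm (z' - z) * norm (newton z')"
proof -
  have "Hyy z *v (newton z' - newton z - Hinv z (gy z' - gy z)) = - ((Hyy z' - Hyy z) *v newton z')"
    by (simp add: matrix_vector_mult_diff_distrib matrix_vector_mult_diff_rdistrib newton_def)
  then have "norm (newton z' - newton z - Hinv z (gy z' - gy z)) \<le> norm ((Hyy z' - Hyy z) *v newton z') / \<mu>"
    using norm_le_Hyy[of "newton z' - newton z - Hinv z (gy z' - gy z)" z] by simp
  also have "\<dots> \<le> Qg * norm (z' - z) * norm (newton z') / \<mu>"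
    using \<mu>_pos by (intro divide_right_mono Hyy_diff_bound) auto
  finally show ?thesis by simp
qed

text \<open>The factor contains \<open>norm (newton z')\<close>, so a uniform Lipschitz constant
  results on sets where the correction is bounded.\<close>

lemma newton_diff_lipschitz:
  "norm (newton z' - newton z) \<le> (Lg / \<mu> + Qg / \<mu> * norm (newton z')) * norm (z' - z)"
proof -
  have "norm (newton z' - newton z)
      \<le> norm (Hinv z (gy z' - gy z)) + norm (newton z' - newton z - Hinv z (gy z' - gy z))"
    using norm_triangle_ineq[of "Hinv z (gy z' - gy z)" "newton z' - newton z - Hinv z (gy z' - gy z)"] by simp
  also have "norm (Hinv z (gy z' - gy z)) \<le> Lg * norm (z' - z) / \<mu>"
    using norm_Hinv[of z "gy z' - gy z"] divide_right_mono[OF gy_lip[of z' z], of \<mu>] \<mu>_pos by simp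
  finally show ?thesis using newton_diff_bound[of z' z] by (simp add: algebra_simps)
qed

text \<open>\<open>Hyy\<close> is never differentiated: \<open>newton \<circ> \<sigma>\<close> is Lipschitz, hence differentiable almost everywhere,
  and the Lipschitz bound of \<open>Hyy\<close> controls the unknown part of its derivative.\<close>
lemma newton_derivative_bound:
  assumes \<sigma>: "(\<sigma> has_vector_derivative u) (at t)"
    and N: "((\<lambda>s. newton (\<sigma> s)) has_vector_derivative n) (at t)"
  shows "norm (n - Hinv (\<sigma> t) (fst u v* Hxy (\<sigma> t) + Hyy (\<sigma> t) *v snd u))
    \<le> Qg / \<mu> * norm u * norm (newton (\<sigma> t))"
proof -
  let ?g' = "fst u v* Hxy (\<sigma> t) + Hyy (\<sigma> t) *v snd u"
  have "(gy \<circ> \<sigma> has_vector_derivative ?g') (at t)"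
    using vector_derivative_diff_chain_within[OF \<sigma>, of gy "\<lambda>(u, v). u v* Hxy (\<sigma> t) + Hyy (\<sigma> t) *v v"]
      has_derivative_at_withinI[OF gy_deriv] by (simp add: case_prod_beta)
  then have g: "((\<lambda>s. (gy (\<sigma> s) - gy (\<sigma> t)) /\<^sub>R (s - t)) \<longlongrightarrow> ?g') (at t)"
    using has_vector_derivative_imp_quotient by force
  have "((\<lambda>s. norm ((newton (\<sigma> s) - newton (\<sigma> t)) /\<^sub>R (s - t) - Hinv (\<sigma> t) ((gy (\<sigma> s) - gy (\<sigma> t)) /\<^sub>R (s - t))))
      \<longlongrightarrow> norm (n - Hinv (\<sigma> t) ?g')) (at t)"
    by (intro tendsto_norm tendsto_diff has_vector_derivative_imp_quotient[OF N]
        bounded_linear.tendsto[OF bounded_linear_Hinv] g)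
  moreover have "((\<lambda>s. Qg / \<mu> * norm ((\<sigma> s - \<sigma> t) /\<^sub>R (s - t)) * norm (newton (\<sigma> s)))
      \<longlongrightarrow> Qg / \<mu> * norm u * norm (newton (\<sigma> t))) (at t)"
    using has_vector_derivative_continuous[OF N] has_vector_derivative_imp_quotient[OF \<sigma>]
    by (intro tendsto_mult tendsto_const tendsto_norm) (auto simp: continuous_within)
  moreover have "norm ((newton (\<sigma> s) - newton (\<sigma> t)) /\<^sub>R (s - t) - Hinv (\<sigma> t) ((gy (\<sigma> s) - gy (\<sigma> t)) /\<^sub>R (s - t)))
      \<le> Qg / \<mu> * norm ((\<sigma> s - \<sigma> t) /\<^sub>R (s - t)) * norm (newton (\<sigma> s))" for s
  proof -
    have "(newton (\<sigma> s) - newton (\<sigma> t)) /\<^sub>R (s - t) - Hinv (\<sigma> t) ((gy (\<sigma> s) - gy (\<sigma> t)) /\<^sub>R (s - t))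
        = (newton (\<sigma> s) - newton (\<sigma> t) - Hinv (\<sigma> t) (gy (\<sigma> s) - gy (\<sigma> t))) /\<^sub>R (s - t)"
      unfolding linear_scale[OF linear_Hinv] by (simp only: scaleR_diff_right)
    moreover have "inverse \<bar>s - t\<bar> * norm (newton (\<sigma> s) - newton (\<sigma> t) - Hinv (\<sigma> t) (gy (\<sigma> s) - gy (\<sigma> t)))
        \<le> inverse \<bar>s - t\<bar> * (Qg / \<mu> * norm (\<sigma> s - \<sigma> t) * norm (newton (\<sigma> s)))"
      by (intro mult_left_mono newton_diff_bound) auto
    ultimately show ?thesis by (simp only: norm_scaleR abs_inverse) (simp add: ac_simps)
  qed
  ultimately show ?thesis
    by (intro tendsto_le[OF trivial_limit_at]) (auto intro!: always_eventually)
qed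

end

section \<open>The Lyapunov function\<close>

text \<open>\<open>a\<close> stands for the norm of \<open>px\<close>, \<open>b\<close> for that of
  \<open>gy\<close>, and \<open>C\<close> for \<open>Mf * Qg\<close>. The first bound on \<beta>
  pays for the error term in \<open>b\<close> squared, the second for the mixed term
  \<open>a * b\<close>; together they consume at most 3/8 of the rate.\<close>

lemma lyapunov_rate_bound:
  fixes a b :: real
  assumes pos: "0 < C" "0 < \<mu>" "0 < Lg" "\<mu> \<le> Lg" "0 \<le> a" "0 \<le> b"
    and beta: "8 * C / \<mu> ^ 3 \<le> \<beta>" "4 * C * Lg / \<mu> powr 3.5 \<le> \<beta>"
  shows "(a\<^sup>2 + \<beta>\<^sup>2 * \<mu> * b\<^sup>2) / 2
    \<le> a\<^sup>2 + \<beta>\<^sup>2 * \<mu> * b\<^sup>2 - C / \<mu>\<^sup>2 * b * (a + \<beta> * b + Lg / \<mu> * a)"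
proof -
  \<comment> \<open>This root is the origin of the exponent 3.5: the mixed term is read as the
    product of \<open>a\<close> and \<open>\<beta> * s * b\<close>, and the square of the latter is
    \<open>\<beta>\<^sup>2 * \<mu> * b\<^sup>2\<close>.\<close>
  define s where "s = sqrt \<mu>"
  have s: "0 < s" "s\<^sup>2 = \<mu>" using pos by (auto simp: s_def)
  have "\<mu> powr 3.5 = \<mu> powr (3 + 1/2)" by simp
  also have "\<dots> = \<mu> ^ 3 * s" unfolding powr_add using pos by (simp add: powr_half_sqrt s_def powr_numeral)
  finally have b2: "4 * (C * Lg) \<le> \<beta> * (\<mu> ^ 3 * s)"
    using beta(2) pos s by (simp add: field_simps)
  have "0 < 8 * C / \<mu> ^ 3" using pos by simp
  then have \<beta>: "0 < \<beta>" using beta(1) by linarith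
  have "C / \<mu>\<^sup>2 \<le> \<beta> * \<mu> / 8"
    using beta(1) pos by (simp add: field_simps power2_eq_square power3_eq_cube)
  then have "C / \<mu>\<^sup>2 * (\<beta> * b\<^sup>2) \<le> \<beta> * \<mu> / 8 * (\<beta> * b\<^sup>2)"
    using \<beta> by (intro mult_right_mono) auto
  then have 1: "C / \<mu>\<^sup>2 * (\<beta> * b\<^sup>2) \<le> \<beta>\<^sup>2 * \<mu> * b\<^sup>2 / 8"
    by (simp add: power2_eq_square ac_simps)
  have "C / \<mu>\<^sup>2 * (1 + Lg / \<mu>) \<le> C / \<mu>\<^sup>2 * (2 * (Lg / \<mu>))"
  proof (rule mult_left_mono)
    have "1 \<le> Lg / \<mu>" using pos by simp
    then show "1 + Lg / \<mu> \<le> 2 * (Lg / \<mu>)" by linarith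
  qed (use pos in simp)
  also have "\<dots> = 2 * (C * Lg) / \<mu> ^ 3" by (simp add: power2_eq_square power3_eq_cube)
  also have "\<dots> \<le> \<beta> * s / 2" using b2 pos by (simp add: field_simps)
  finally have "C / \<mu>\<^sup>2 * (1 + Lg / \<mu>) * (a * b) \<le> \<beta> * s / 2 * (a * b)"
    using pos by (intro mult_right_mono) auto
  also have "\<dots> \<le> (a\<^sup>2 + \<beta>\<^sup>2 * \<mu> * b\<^sup>2) / 4"
    using sum_squares_bound[of a "\<beta> * s * b"] s(2) by (simp add: power_mult_distrib ac_simps)
  finally have 2: "C / \<mu>\<^sup>2 * (1 + Lg / \<mu>) * (a * b) \<le> (a\<^sup>2 + \<beta>\<^sup>2 * \<mu> * b\<^sup>2) / 4" .
  have 3: "C / \<mu>\<^sup>2 * b * (a + \<beta> * b + Lg / \<mu> * a)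
      = C / \<mu>\<^sup>2 * (\<beta> * b\<^sup>2) + C / \<mu>\<^sup>2 * (1 + Lg / \<mu>) * (a * b)"
    by (simp add: algebra_simps power2_eq_square add_divide_distrib)
  have combine: "(X + Y) / 2 \<le> X + Y - P"
    if "P = A + B" "A \<le> Y / 8" "B \<le> (X + Y) / 4" "0 \<le> X" "0 \<le> Y" for X Y A B P :: real
    using that by (simp add: field_simps)
  show ?thesis by (rule combine[OF 3 1 2]) (use pos in simp_all)
qed

section \<open>The vector field of the bilevel problem\<close>

locale bilevel = lower_level gy Hxy Hyy \<mu> Lg Qg
  for gy :: "(real^'n) \<times> (real^'p) \<Rightarrow> real^'p"
    and Hxy :: "(real^'n) \<times> (real^'p) \<Rightarrow> real^'p^'n"
    and Hyy :: "(real^'n) \<times> (real^'p) \<Rightarrow> real^'p^'p"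
    and \<mu> Lg Qg :: real +
  fixes f :: "(real^'n) \<times> (real^'p) \<Rightarrow> real"
    and Df :: "(real^'n) \<times> (real^'p) \<Rightarrow> ((real^'n) \<times> (real^'p)) set"
    and Mf \<beta> :: real
  assumes Mf_pos: "0 < Mf"
    and f_lip: "Mf-lipschitz_on UNIV f"
    and Df_graph: "closed {(z, d). d \<in> Df z}"
    and Df_compact: "\<And>z. compact (Df z)"
    and Df_convex: "\<And>z. convex (Df z)"
    and Df_bound: "\<And>z d. d \<in> Df z \<Longrightarrow> norm d \<le> Mf"
    and f_pot: "potential_of f Df"
    and beta1: "8 * (Mf * Qg) / \<mu> ^ 3 \<le> \<beta>"
    and beta2: "4 * (Mf * Qg) * Lg / \<mu> powr 3.5 \<le> \<beta>"
begin

lemma \<beta>_pos: "0 < \<beta>"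
proof -
  have "0 < 8 * (Mf * Qg) / \<mu> ^ 3" using Mf_pos Qg_pos \<mu>_pos by simp
  then show ?thesis using beta1 by linarith
qed

definition px :: "(real^'n) \<times> (real^'p) \<Rightarrow> (real^'n) \<times> (real^'p) \<Rightarrow> real^'n"
  where "px z d = fst d - Hxy z *v Hinv z (snd d)"

definition dir :: "(real^'n) \<times> (real^'p) \<Rightarrow> (real^'n) \<times> (real^'p) \<Rightarrow> (real^'n) \<times> (real^'p)"
  where "dir z d = (px z d, \<beta> *\<^sub>R gy z - Hinv z (transpose (Hxy z) *v px z d))"

text \<open>\<open>Df\<close> is evaluated at the exact Newton point, whereas the algorithm uses an
  inexact one; the two agree in the limit.\<close>

definition field :: "(real^'n) \<times> (real^'p) \<Rightarrow> ((real^'n) \<times> (real^'p)) set"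
  where "field z = dir z ` Df (fst z, Amap Hyy gy z)"

lemma dir_tendsto:
  assumes "(z \<longlongrightarrow> z0) F" "(d \<longlongrightarrow> d0) F"
  shows "((\<lambda>j. dir (z j) (d j)) \<longlongrightarrow> dir z0 d0) F"
proof -
  have "((\<lambda>j. px (z j) (d j)) \<longlongrightarrow> px z0 d0) F"
    unfolding px_def using assms
    by (intro tendsto_diff tendsto_fst tendsto_snd Hxy_tendsto Hinv_tendsto)
  then show ?thesis
    unfolding dir_def using assms
    by (intro tendsto_Pair tendsto_diff tendsto_scaleR tendsto_const gy_tendsto Hinv_tendsto transpose_Hxy_tendsto)
qed

lemma norm_px: "norm (px z d) \<le> (1 + Lg / \<mu>) * norm d"
proof -
  have "norm (px z d) \<le> norm (fst d) + norm (Hxy z *v Hinv z (snd d))"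
    unfolding px_def by (rule norm_triangle_ineq4)
  also have "\<dots> \<le> norm (fst d) + Lg * (norm (snd d) / \<mu>)"
    using norm_Hxy[of z "Hinv z (snd d)"] mult_left_mono[OF norm_Hinv[of z "snd d"], of Lg] Lg_pos by simp
  also have "\<dots> \<le> norm d + Lg * (norm d / \<mu>)"
    using Lg_pos \<mu>_pos norm_fst_le[of "fst d" "snd d"] norm_snd_le[of "snd d" "fst d"]
    by (intro add_mono mult_left_mono divide_right_mono) auto
  finally show ?thesis by (simp add: algebra_simps)
qed

lemma norm_dir: "norm (dir z d) \<le> norm (px z d) + \<beta> * norm (gy z) + Lg / \<mu> * norm (px z d)"
proof -
  have "norm (dir z d) \<le> norm (px z d) + norm (\<beta> *\<^sub>R gy z - Hinv z (transpose (Hxy z) *v px z d))"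
    unfolding dir_def by (rule norm_Pair_le)
  also have "norm (\<beta> *\<^sub>R gy z - Hinv z (transpose (Hxy z) *v px z d))
      \<le> \<beta> * norm (gy z) + norm (Hinv z (transpose (Hxy z) *v px z d))"
    using norm_triangle_ineq4[of "\<beta> *\<^sub>R gy z" "Hinv z (transpose (Hxy z) *v px z d)"] \<beta>_pos by simp
  also have "norm (Hinv z (transpose (Hxy z) *v px z d)) \<le> Lg * norm (px z d) / \<mu>"
    using norm_Hinv[of z "transpose (Hxy z) *v px z d"] divide_right_mono[OF norm_transpose_Hxy[of z "px z d"], of \<mu>] \<mu>_pos
    by (meson less_imp_le order_trans)
  finally show ?thesis by simp
qed

text \<open>\<open>dir z\<close> is affine in its second argument, which transfers convexity and
  compactness from \<open>Df\<close> to \<open>field\<close>.\<close>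

lemma linear_dir: "linear (\<lambda>d. dir z d - (0, \<beta> *\<^sub>R gy z))"
proof -
  have px: "px z (d + e) = px z d + px z e" "px z (c *\<^sub>R d) = c *\<^sub>R px z d" for d e c
    by (simp_all add: px_def linear_add[OF linear_Hinv] linear_scale[OF linear_Hinv] matrix_vector_right_distrib
        matrix_vector_mult_scaleR scaleR_diff_right)
  show ?thesis
    by (rule linearI)
      (simp_all add: dir_def px linear_add[OF linear_Hinv] linear_scale[OF linear_Hinv]
        matrix_vector_right_distrib matrix_vector_mult_scaleR del: transpose_matrix_vector)
qed

lemma field_eq: "field z = (+) (0, \<beta> *\<^sub>R gy z) ` (\<lambda>d. dir z d - (0, \<beta> *\<^sub>R gy z)) ` Df (fst z, Amap Hyy gy z)"
  unfolding field_def image_image by simp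

lemma convex_field: "convex (field z)"
  unfolding field_eq by (intro convex_translation convex_linear_image[OF linear_dir] Df_convex)

lemma closed_field: "closed (field z)"
  unfolding field_eq
  by (intro compact_imp_closed compact_translation compact_continuous_image Df_compact
      linear_continuous_on linear_conv_bounded_linear[THEN iffD1] linear_dir)

text \<open>The points \<open>c j\<close> only have to converge to the Newton point, which
  accommodates the inexact solves. The bounded \<open>d j\<close> have a convergent subsequence, and
  the graph of \<open>Df\<close> is closed.\<close>

lemma field_limit:
  assumes z: "z \<longlonglongrightarrow> z0" and c: "c \<longlonglongrightarrow> (fst z0, Amap Hyy gy z0)"
    and d: "\<And>j. d j \<in> Df (c j)" and u: "(\<lambda>j::nat. dir (z j) (d j)) \<longlonglongrightarrow> u"
  shows "u \<in> field z0"
proof -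
  have "bounded (range d)" by (rule boundedI[of _ Mf]) (use d Df_bound in blast)
  then obtain d0 r where r: "strict_mono r" "(d \<circ> r) \<longlonglongrightarrow> d0"
    using bounded_imp_convergent_subsequence by blast
  have lim: "(\<lambda>j. (c (r j), d (r j))) \<longlonglongrightarrow> ((fst z0, Amap Hyy gy z0), d0)"
    using LIMSEQ_subseq_LIMSEQ[OF c r(1)] r(2) by (intro tendsto_Pair) (auto simp: o_def)
  have "((fst z0, Amap Hyy gy z0), d0) \<in> {(z, d). d \<in> Df z}"
    by (rule closed_sequentially[OF Df_graph _ lim]) (use d in auto)
  then have "d0 \<in> Df (fst z0, Amap Hyy gy z0)" by simp
  moreover have "(\<lambda>j. dir (z (r j)) (d (r j))) \<longlonglongrightarrow> dir z0 d0"
    using LIMSEQ_subseq_LIMSEQ[OF z r(1)] r(2) by (intro dir_tendsto) (auto simp: o_def)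
  then have "u = dir z0 d0"
    using LIMSEQ_subseq_LIMSEQ[OF u r(1)] LIMSEQ_unique by (auto simp: o_def)
  ultimately show ?thesis by (simp add: field_def)
qed

text \<open>If the first component of \<open>dir\<close> vanishes, so does the correction in the
  second, leaving \<open>\<beta> *\<^sub>R gy z = 0\<close>. Then the Newton correction is 0 and
  \<open>Df\<close> is evaluated at \<open>z\<close> itself.\<close>

lemma zero_in_field_iff: "0 \<in> field z \<longleftrightarrow> BLO_stationary Df Hxy Hyy gy z"
proof
  assume "0 \<in> field z"
  then obtain d where d: "d \<in> Df (fst z, Amap Hyy gy z)" "dir z d = 0" by (auto simp: field_def)
  then have p: "px z d = 0" by (simp add: dir_def zero_prod_def)
  with d(2) have "gy z = 0"
    using \<beta>_pos linear_0[OF linear_Hinv] by (simp add: dir_def zero_prod_def)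
  moreover from this have "Amap Hyy gy z = snd z"
    by (simp add: Amap_eq newton_def linear_0[OF linear_Hinv])
  ultimately show "BLO_stationary Df Hxy Hyy gy z"
    using d(1) p unfolding BLO_stationary_def px_def Hinv_def by (cases d) auto
next
  assume "BLO_stationary Df Hxy Hyy gy z"
  then obtain dx dy where d: "(dx, dy) \<in> Df z" "px z (dx, dy) = 0" and g: "gy z = 0"
    by (auto simp: BLO_stationary_def px_def Hinv_def)
  have "Amap Hyy gy z = snd z" by (simp add: Amap_eq newton_def linear_0[OF linear_Hinv] g)
  then show "0 \<in> field z"
    unfolding field_def using d g
    by (intro image_eqI[of _ _ "(dx, dy)"]) (auto simp: dir_def zero_prod_def linear_0[OF linear_Hinv])
qed

text \<open>Turns the condition on the critical values of \<open>f\<close> into one on those of the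
  Lyapunov function.\<close>

lemma hfun_stationary: "BLO_stationary Df Hxy Hyy gy z \<Longrightarrow> hfun f \<beta> Hyy gy z = f z"
  by (auto simp: BLO_stationary_def hfun_def Amap_eq newton_def linear_0[OF linear_Hinv])

lemma Amap_tendsto: "(z \<longlongrightarrow> z0) F \<Longrightarrow> ((\<lambda>j. Amap Hyy gy (z j)) \<longlongrightarrow> Amap Hyy gy z0) F"
  unfolding Amap_eq by (intro tendsto_diff tendsto_snd newton_tendsto)

lemma hfun_continuous: "continuous_on UNIV (hfun f \<beta> Hyy gy)"
proof (rule continuous_at_imp_continuous_on, rule ballI)
  fix z0
  have f: "((\<lambda>z. f (c z)) \<longlongrightarrow> f c0) F" if "(c \<longlongrightarrow> c0) F" for c c0 and F :: "'z filter"
    by (rule continuous_on_tendsto_compose[OF lipschitz_on_continuous_on[OF f_lip] that]) auto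
  have "((\<lambda>z. f (fst z, Amap Hyy gy z) + \<beta> / 2 * (norm (gy z))\<^sup>2)
      \<longlongrightarrow> f (fst z0, Amap Hyy gy z0) + \<beta> / 2 * (norm (gy z0))\<^sup>2) (at z0)"
    by (intro tendsto_intros f Amap_tendsto gy_tendsto)
  then show "isCont (hfun f \<beta> Hyy gy) z0" by (simp add: isCont_def hfun_def[abs_def])
qed

lemma stationary_limit:
  assumes z: "z \<longlonglongrightarrow> z0" and 0: "\<And>j::nat. 0 \<in> field (z j)"
  shows "0 \<in> field z0"
proof -
  have "\<forall>j. \<exists>d. d \<in> Df (fst (z j), Amap Hyy gy (z j)) \<and> dir (z j) d = 0"
    using 0 unfolding field_def by (metis imageE)
  from choice[OF this] obtain d where d: "\<And>j. d j \<in> Df (fst (z j), Amap Hyy gy (z j))"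
    "\<And>j. dir (z j) (d j) = 0" by blast
  show ?thesis
    by (rule field_limit[OF z tendsto_Pair[OF tendsto_fst[OF z] Amap_tendsto[OF z]] d(1)]) (simp add: d(2))
qed

section \<open>Growth of the Lyapunov function against the flow\<close>

text \<open>The right-hand side is the rate of \<open>hfun\<close> along the curve: the integrand
  for \<open>f\<close> plus the derivative of the quadratic term. It is nonnegative since the motion
  is along \<open>dir\<close>, against the flow.\<close>

lemma field_integrand_lower_bound:
  assumes \<sigma>: "(\<sigma> has_vector_derivative u) (at t)"
    and c: "((\<lambda>s. (fst (\<sigma> s), Amap Hyy gy (\<sigma> s))) has_vector_derivative c') (at t)"
    and d: "d \<in> Df (fst (\<sigma> t), Amap Hyy gy (\<sigma> t))" and u: "u = T *\<^sub>R dir (\<sigma> t) d" and T: "0 < T"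
  shows "T * (((norm (px (\<sigma> t) d))\<^sup>2 + \<beta>\<^sup>2 * \<mu> * (norm (gy (\<sigma> t)))\<^sup>2) / 2)
    \<le> field_integrand Df (\<lambda>s. (fst (\<sigma> s), Amap Hyy gy (\<sigma> s))) t
      + \<beta> * (gy (\<sigma> t) \<bullet> (fst u v* Hxy (\<sigma> t) + Hyy (\<sigma> t) *v snd u))"
proof -
  let ?z = "\<sigma> t" and ?c = "\<lambda>s. (fst (\<sigma> s), Amap Hyy gy (\<sigma> s))"
  let ?p = "px ?z d" and ?g' = "fst u v* Hxy ?z + Hyy ?z *v snd u"
  have "bdd_above ((\<lambda>v. c' \<bullet> v) ` Df (?c t))"
  proof (rule bdd_aboveI2)
    fix v assume "v \<in> Df (?c t)"
    then have "norm c' * norm v \<le> norm c' * Mf" by (intro mult_left_mono Df_bound) auto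
    then show "c' \<bullet> v \<le> norm c' * Mf" using norm_cauchy_schwarz[of c' v] by linarith
  qed
  then have sup: "c' \<bullet> d \<le> field_integrand Df ?c t"
    unfolding field_integrand_def vector_derivative_at[OF c] using d by (intro cSup_upper) auto
  have "((\<lambda>s. fst (\<sigma> s)) has_vector_derivative fst u) (at t)"
    "((\<lambda>s. fst (\<sigma> s)) has_vector_derivative fst c') (at t)"
    using bounded_linear.has_vector_derivative[OF bounded_linear_fst \<sigma>]
      bounded_linear.has_vector_derivative[OF bounded_linear_fst c] by simp_all
  then have fst_c': "fst c' = fst u" by (rule vector_derivative_unique_at[symmetric])
  define n where "n = snd u - snd c'"
  have "((\<lambda>s. snd (\<sigma> s) - snd (?c s)) has_vector_derivative n) (at t)"
    unfolding n_def
    by (intro has_vector_derivative_diff bounded_linear.has_vector_derivative[OF bounded_linear_snd] \<sigma> c)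
  then have n: "((\<lambda>s. newton (\<sigma> s)) has_vector_derivative n) (at t)" by (simp add: Amap_eq)
  \<comment> \<open>The part of the derivative of the Newton correction that comes from the
    variation of the Hessian; only its norm is controlled.\<close>
  define e where "e = n - Hinv ?z ?g'"
  have fst_u: "fst u = T *\<^sub>R ?p" and snd_u: "snd u = T *\<^sub>R (\<beta> *\<^sub>R gy ?z - Hinv ?z (transpose (Hxy ?z) *v ?p))"
    by (simp_all add: u dir_def)
  have g': "?g' = (T * \<beta>) *\<^sub>R (Hyy ?z *v gy ?z)"
    unfolding transpose_matrix_vector[symmetric] fst_u snd_u
    by (simp add: matrix_vector_mult_scaleR matrix_vector_mult_diff_distrib scaleR_diff_right
        del: transpose_matrix_vector)
  then have Hg': "Hinv ?z ?g' = (T * \<beta>) *\<^sub>R gy ?z" by (simp add: linear_scale[OF linear_Hinv])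
  have "snd c' = snd u - (T * \<beta>) *\<^sub>R gy ?z - e" unfolding e_def n_def Hg' by simp
  then have "snd c' = - (T *\<^sub>R Hinv ?z (transpose (Hxy ?z) *v ?p)) - e"
    unfolding snd_u by (simp add: scaleR_diff_right)
  then have "c' \<bullet> d = T * (?p \<bullet> fst d) - T * (Hinv ?z (transpose (Hxy ?z) *v ?p) \<bullet> snd d) - e \<bullet> snd d"
    by (simp add: inner_prod_def fst_c' fst_u inner_diff_left del: transpose_matrix_vector)
  \<comment> \<open>Symmetry of the inverse Hessian makes this a pairing with \<open>px\<close>,
    after which \<open>fst d\<close> and \<open>snd d\<close> recombine to \<open>px\<close>
    itself.\<close>
  also have "Hinv ?z (transpose (Hxy ?z) *v ?p) \<bullet> snd d = ?p \<bullet> (Hxy ?z *v Hinv ?z (snd d))"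
    by (simp add: Hinv_sym dot_lmul_matrix)
  finally have c'd: "c' \<bullet> d = T * (norm ?p)\<^sup>2 - e \<bullet> snd d"
    by (simp add: power2_norm_eq_inner px_def inner_diff_right right_diff_distrib)
  let ?a = "norm ?p" and ?b = "norm (gy ?z)"
  have "e \<bullet> snd d \<le> norm e * norm (snd d)" by (rule norm_cauchy_schwarz)
  also have "\<dots> \<le> norm e * Mf"
    using Df_bound[OF d] norm_snd_le[of "snd d" "fst d"] by (intro mult_left_mono) auto
  also have "norm e \<le> Qg / \<mu> * norm u * norm (newton ?z)"
    unfolding e_def by (rule newton_derivative_bound[OF \<sigma> n])
  also have "\<dots> \<le> Qg / \<mu> * (T * (?a + \<beta> * ?b + Lg / \<mu> * ?a)) * (?b / \<mu>)"
    using norm_newton[of ?z] norm_dir[of ?z d] T Qg_pos \<mu>_pos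
    by (intro mult_mono) (auto simp: u mult_nonneg_nonneg \<beta>_pos less_imp_le Lg_pos)
  finally have "e \<bullet> snd d \<le> Qg / \<mu> * (T * (?a + \<beta> * ?b + Lg / \<mu> * ?a)) * (?b / \<mu>) * Mf"
    using Mf_pos by simp
  also have "\<dots> = T * ((Mf * Qg) / \<mu>\<^sup>2 * ?b * (?a + \<beta> * ?b + Lg / \<mu> * ?a))"
    by (simp add: power2_eq_square)
  finally have e_le: "e \<bullet> snd d \<le> T * ((Mf * Qg) / \<mu>\<^sup>2 * ?b * (?a + \<beta> * ?b + Lg / \<mu> * ?a))" .
  have "T * (\<beta>\<^sup>2 * (\<mu> * ?b\<^sup>2)) \<le> T * (\<beta>\<^sup>2 * (gy ?z \<bullet> (Hyy ?z *v gy ?z)))"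
    using T Hyy_pd[of "gy ?z" ?z] by (intro mult_left_mono) auto
  also have "\<dots> = \<beta> * (gy ?z \<bullet> ?g')" unfolding g' by (simp add: power2_eq_square)
  finally have q: "T * (\<beta>\<^sup>2 * (\<mu> * ?b\<^sup>2)) \<le> \<beta> * (gy ?z \<bullet> ?g')" .
  have "T * ((?a\<^sup>2 + \<beta>\<^sup>2 * \<mu> * ?b\<^sup>2) / 2)
      \<le> T * (?a\<^sup>2 + \<beta>\<^sup>2 * \<mu> * ?b\<^sup>2 - (Mf * Qg) / \<mu>\<^sup>2 * ?b * (?a + \<beta> * ?b + Lg / \<mu> * ?a))"
    using T Mf_pos Qg_pos \<mu>_pos Lg_pos \<mu>_le_Lg beta1 beta2
    by (intro mult_left_mono lyapunov_rate_bound) auto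
  also have "\<dots> = T * ?a\<^sup>2 - T * ((Mf * Qg) / \<mu>\<^sup>2 * ?b * (?a + \<beta> * ?b + Lg / \<mu> * ?a)) + T * (\<beta>\<^sup>2 * (\<mu> * ?b\<^sup>2))"
    by (simp add: right_diff_distrib distrib_left mult.assoc)
  also have "\<dots> \<le> field_integrand Df ?c t + \<beta> * (gy ?z \<bullet> ?g')"
    using e_le q sup c'd by linarith
  finally show ?thesis .
qed

text \<open>The curve is traversed against the flow, because the supremum in \<open>field_integrand\<close>
  dominates the element of \<open>Df\<close> that generates the derivative, whatever element that is.\<close>
lemma ascent:
  assumes lip: "K-lipschitz_on UNIV \<sigma>" and bdd: "bounded (range \<sigma>)" and T: "0 < T"
    and der: "\<And>t u. \<lbrakk>t \<in> {0<..<1}; (\<sigma> has_vector_derivative u) (at t)\<rbrakk> \<Longrightarrow> \<exists>w\<in>field (\<sigma> t). u = T *\<^sub>R w"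
    and ns: "0 \<notin> field (\<sigma> 1)"
  shows "hfun f \<beta> Hyy gy (\<sigma> 0) < hfun f \<beta> Hyy gy (\<sigma> 1)"
proof -
  obtain R where R: "\<And>t. norm (\<sigma> t) \<le> R" using bdd unfolding bounded_iff by blast
  have K: "0 \<le> K" using lipschitz_on_nonneg[OF lip] .
  have \<sigma>_lip: "norm (\<sigma> s - \<sigma> t) \<le> K * \<bar>s - t\<bar>" for s t
    using lipschitz_onD[OF lip, of s t] by (simp add: dist_norm)
  define Bg where "Bg = norm (gy 0) + Lg * R"
  have Bg: "norm (gy (\<sigma> t)) \<le> Bg" for t
  proof -
    have "norm (gy (\<sigma> t)) \<le> norm (gy 0) + norm (gy (\<sigma> t) - gy 0)"
      using norm_triangle_ineq[of "gy 0" "gy (\<sigma> t) - gy 0"] by simp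
    also have "norm (gy (\<sigma> t) - gy 0) \<le> Lg * R"
      using gy_lip[of "\<sigma> t" 0] mult_left_mono[OF R[of t] less_imp_le[OF Lg_pos]] 
      unfolding diff_zero by linarith
    finally show ?thesis by (simp add: Bg_def)
  qed
  have Bg0: "0 \<le> Bg" using Bg[of 0] norm_ge_zero order_trans by blast
  \<comment> \<open>The bounded range of \<sigma> bounds the Newton correction and so yields a
    single Lipschitz constant along the curve.\<close>
  define KN where "KN = Lg / \<mu> + Qg / \<mu> * (Bg / \<mu>)"
  have KN: "0 \<le> KN" using Lg_pos \<mu>_pos Qg_pos Bg0 by (simp add: KN_def)
  have newton_lip: "norm (newton (\<sigma> s) - newton (\<sigma> t)) \<le> KN * (K * \<bar>s - t\<bar>)" for s t
  proof -
    have "norm (newton (\<sigma> s)) \<le> Bg / \<mu>"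
      using norm_newton[of "\<sigma> s"] divide_right_mono[OF Bg[of s] less_imp_le[OF \<mu>_pos]] by linarith
    then have "Lg / \<mu> + Qg / \<mu> * norm (newton (\<sigma> s)) \<le> KN"
      unfolding KN_def using Qg_pos \<mu>_pos by (intro add_left_mono mult_left_mono) auto
    then have "(Lg / \<mu> + Qg / \<mu> * norm (newton (\<sigma> s))) * norm (\<sigma> s - \<sigma> t) \<le> KN * (K * \<bar>s - t\<bar>)"
      using \<sigma>_lip[of s t] KN by (intro mult_mono) auto
    then show ?thesis using newton_diff_lipschitz[of "\<sigma> s" "\<sigma> t"] by simp
  qed
  define c where "c = (\<lambda>s. (fst (\<sigma> s), Amap Hyy gy (\<sigma> s)))"
  have c_lip: "(K + (K + KN * K))-lipschitz_on UNIV c"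
  proof (rule lipschitz_onI)
    show "0 \<le> K + (K + KN * K)" using K KN by simp
    fix s t
    have "dist (c s) (c t) \<le> norm (fst (\<sigma> s - \<sigma> t)) + norm (snd (\<sigma> s - \<sigma> t) - (newton (\<sigma> s) - newton (\<sigma> t)))"
      unfolding dist_norm c_def Amap_eq diff_Pair
      using norm_Pair_le[of "fst (\<sigma> s - \<sigma> t)" "snd (\<sigma> s - \<sigma> t) - (newton (\<sigma> s) - newton (\<sigma> t))"]
      by (simp add: algebra_simps)
    also have "\<dots> \<le> norm (\<sigma> s - \<sigma> t) + (norm (\<sigma> s - \<sigma> t) + norm (newton (\<sigma> s) - newton (\<sigma> t)))"
      using norm_fst_le[of "fst (\<sigma> s - \<sigma> t)" "snd (\<sigma> s - \<sigma> t)"] norm_snd_le[of "snd (\<sigma> s - \<sigma> t)" "fst (\<sigma> s - \<sigma> t)"]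
        norm_triangle_ineq4[of "snd (\<sigma> s - \<sigma> t)" "newton (\<sigma> s) - newton (\<sigma> t)"]
      unfolding prod.collapse by linarith
    also have "\<dots> \<le> (K + (K + KN * K)) * dist s t"
      using \<sigma>_lip[of s t] newton_lip[of s t] by (simp add: dist_real_def algebra_simps)
    finally show "dist (c s) (c t) \<le> (K + (K + KN * K)) * dist s t" .
  qed
  define N where "N = {t. \<not> \<sigma> differentiable (at t)} \<union> {t. \<not> c differentiable (at t)}"
  have N: "negligible N"
    unfolding N_def by (intro negligible_Un lipschitz_differentiable_ae[OF lip] lipschitz_differentiable_ae[OF c_lip])
  define u where "u t = vector_derivative \<sigma> (at t)" for t
  have u: "(\<sigma> has_vector_derivative u t) (at t)" if "t \<notin> N" for t
    using that vector_derivative_works[of \<sigma> "at t"] by (simp add: N_def u_def)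
  define q where "q t = \<beta> / 2 * (norm (gy (\<sigma> t)))\<^sup>2" for t
  define g' where "g' t = fst (u t) v* Hxy (\<sigma> t) + Hyy (\<sigma> t) *v snd (u t)" for t
  have q_lip: "(\<beta> * Bg * (Lg * K))-lipschitz_on UNIV q"
  proof (rule lipschitz_onI)
    show "0 \<le> \<beta> * Bg * (Lg * K)" using \<beta>_pos Bg0 Lg_pos K by simp
    fix s t
    let ?a = "norm (gy (\<sigma> s))" and ?b = "norm (gy (\<sigma> t))"
    have "\<bar>?a\<^sup>2 - ?b\<^sup>2\<bar> = \<bar>?a - ?b\<bar> * (?a + ?b)"
      by (simp add: power2_eq_square square_diff_square_factored abs_mult)
    also have "\<dots> \<le> (Lg * K * \<bar>s - t\<bar>) * (Bg + Bg)"
    proof (intro mult_mono add_mono Bg)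
      have "\<bar>?a - ?b\<bar> \<le> Lg * norm (\<sigma> s - \<sigma> t)"
        using norm_triangle_ineq3[of "gy (\<sigma> s)" "gy (\<sigma> t)"] gy_lip[of "\<sigma> s" "\<sigma> t"] by linarith
      then show "\<bar>?a - ?b\<bar> \<le> Lg * K * \<bar>s - t\<bar>"
        using mult_left_mono[OF \<sigma>_lip[of s t] less_imp_le[OF Lg_pos]] unfolding mult.assoc by linarith
    qed (use Lg_pos K in auto)
    finally have "\<beta> / 2 * \<bar>?a\<^sup>2 - ?b\<^sup>2\<bar> \<le> \<beta> / 2 * ((Lg * K * \<bar>s - t\<bar>) * (Bg + Bg))"
      using \<beta>_pos by (intro mult_left_mono) auto
    moreover have "dist (q s) (q t) = \<beta> / 2 * \<bar>?a\<^sup>2 - ?b\<^sup>2\<bar>"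
      unfolding q_def dist_real_def right_diff_distrib[symmetric] abs_mult using \<beta>_pos by simp
    ultimately show "dist (q s) (q t) \<le> \<beta> * Bg * (Lg * K) * dist s t"
      by (simp add: dist_real_def algebra_simps)
  qed
  have q_der: "(q has_real_derivative \<beta> * (gy (\<sigma> t) \<bullet> g' t)) (at t)" if "t \<notin> N" for t
  proof -
    have "(gy \<circ> \<sigma> has_vector_derivative g' t) (at t)"
      using vector_derivative_diff_chain_within[OF u[OF that], of gy "\<lambda>(u, v). u v* Hxy (\<sigma> t) + Hyy (\<sigma> t) *v v"]
        has_derivative_at_withinI[OF gy_deriv] by (simp add: case_prod_beta g'_def)
    then have "((\<lambda>s. gy (\<sigma> s)) has_vector_derivative g' t) (at t)" by (simp add: o_def)
    from bounded_bilinear.has_vector_derivative[OF bounded_bilinear_inner this this]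
    have "((\<lambda>s. gy (\<sigma> s) \<bullet> gy (\<sigma> s)) has_real_derivative gy (\<sigma> t) \<bullet> g' t + g' t \<bullet> gy (\<sigma> t)) (at t)"
      by (simp add: has_real_derivative_iff_has_vector_derivative)
    from DERIV_cmult[OF this, of "\<beta> / 2"] show ?thesis
      by (simp add: q_def[abs_def] power2_norm_eq_inner inner_commute)
  qed
  \<comment> \<open>A density for the growth of \<open>hfun\<close> along \<sigma>, obtained without
    differentiating \<open>f\<close>: the potential property integrates the first summand, and the
    Lipschitz quadratic term has the second as its derivative.\<close>
  define I where "I t = field_integrand Df c t + \<beta> * (gy (\<sigma> t) \<bullet> g' t)" for t
  have "((\<lambda>t. \<beta> * (gy (\<sigma> t) \<bullet> g' t)) has_integral (q 1 - q 0)) {0..1}"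
    by (rule lipschitz_has_integral_derivative[OF q_lip _ N]) (use q_der in auto)
  moreover have "(field_integrand Df c has_integral (f (c 1) - f (c 0))) {0..1}"
    using f_pot lipschitz_imp_abs_cont_01[OF c_lip] unfolding potential_of_def by blast
  ultimately have int_I: "(I has_integral (hfun f \<beta> Hyy gy (\<sigma> 1) - hfun f \<beta> Hyy gy (\<sigma> 0))) {0..1}"
    unfolding I_def using has_integral_add[of "field_integrand Df c" "f (c 1) - f (c 0)" "{0..1}"]
    by (fastforce simp: hfun_def c_def q_def algebra_simps)
  have key: "0 \<le> I t \<and> (I t = 0 \<longrightarrow> 0 \<in> field (\<sigma> t))" if t: "t \<in> {0<..<1}" "t \<notin> N" for t
  proof -
    obtain w where w: "w \<in> field (\<sigma> t)" "u t = T *\<^sub>R w" using der[OF t(1) u[OF t(2)]] by blast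
    then obtain d where d: "d \<in> Df (fst (\<sigma> t), Amap Hyy gy (\<sigma> t))" "w = dir (\<sigma> t) d" by (auto simp: field_def)
    have "(c has_vector_derivative vector_derivative c (at t)) (at t)"
      using t(2) vector_derivative_works[of c "at t"] by (simp add: N_def)
    from field_integrand_lower_bound[OF u[OF t(2)] this[unfolded c_def] d(1) w(2)[unfolded d(2)] T]
    have I: "T * (((norm (px (\<sigma> t) d))\<^sup>2 + \<beta>\<^sup>2 * \<mu> * (norm (gy (\<sigma> t)))\<^sup>2) / 2) \<le> I t"
      unfolding I_def g'_def c_def .
    have nn: "0 \<le> (norm (px (\<sigma> t) d))\<^sup>2" "0 \<le> \<beta>\<^sup>2 * \<mu> * (norm (gy (\<sigma> t)))\<^sup>2" using \<mu>_pos by auto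
    then have "0 \<le> T * (((norm (px (\<sigma> t) d))\<^sup>2 + \<beta>\<^sup>2 * \<mu> * (norm (gy (\<sigma> t)))\<^sup>2) / 2)"
      using T by simp
    moreover have "0 \<in> field (\<sigma> t)" if "I t = 0"
    proof -
      have "(norm (px (\<sigma> t) d))\<^sup>2 + \<beta>\<^sup>2 * \<mu> * (norm (gy (\<sigma> t)))\<^sup>2 \<le> 0"
        using I that T by (simp add: mult_le_0_iff)
      then have "(norm (px (\<sigma> t) d))\<^sup>2 = 0" "\<beta>\<^sup>2 * \<mu> * (norm (gy (\<sigma> t)))\<^sup>2 = 0" using nn by linarith+
      then have "px (\<sigma> t) d = 0" "gy (\<sigma> t) = 0" using \<beta>_pos \<mu>_pos by auto
      then have "dir (\<sigma> t) d = 0" by (simp add: dir_def zero_prod_def linear_0[OF linear_Hinv])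
      then show ?thesis using d(1) unfolding field_def by (metis imageI)
    qed
    ultimately show ?thesis using I by linarith
  qed
  define N' where "N' = N \<union> {0, 1}"
  have N': "negligible N'" unfolding N'_def by (rule negligible_Un[OF N negligible_finite]) simp
  \<comment> \<open>Nonnegativity of \<open>I\<close> is known off a null set and inside the open
    interval; \<open>J\<close> extends it to all of \<open>{0..1}\<close> without changing the
    integral.\<close>
  define J where "J t = (if t \<in> N' then 0 else I t)" for t
  have int_J: "(J has_integral (hfun f \<beta> Hyy gy (\<sigma> 1) - hfun f \<beta> Hyy gy (\<sigma> 0))) {0..1}"
    by (rule has_integral_spike[OF N' _ int_I]) (simp add: J_def)
  have J0: "0 \<le> J t" if "t \<in> {0..1}" for t
    using key[of t] that by (cases "t \<in> N'") (auto simp: J_def N'_def)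
  have "0 \<le> hfun f \<beta> Hyy gy (\<sigma> 1) - hfun f \<beta> Hyy gy (\<sigma> 0)"
    using has_integral_nonneg[OF int_J J0] by simp
  moreover have "hfun f \<beta> Hyy gy (\<sigma> 1) - hfun f \<beta> Hyy gy (\<sigma> 0) \<noteq> 0"
  proof
    assume "hfun f \<beta> Hyy gy (\<sigma> 1) - hfun f \<beta> Hyy gy (\<sigma> 0) = 0"
    then have "(J has_integral 0) {0..1}" using int_J by simp
    then have "negligible {t \<in> {0..1}. J t \<noteq> 0}" using J0 by (rule negligible_nonzero_if_integral_0)
    with N' have M: "negligible (N' \<union> {t \<in> {0..1}. J t \<noteq> 0})" by (rule negligible_Un)
    \<comment> \<open>A vanishing integral makes almost every point of the curve stationary.
      Stationary times then accumulate at 1, and closedness of the stationary set contradicts the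
      choice of \<open>\<sigma> 1\<close>.\<close>
    have "\<forall>j. \<exists>t. 1 - inverse (real (Suc j)) < t \<and> t < 1 \<and> 0 \<in> field (\<sigma> t)"
    proof
      fix j
      have "\<not> negligible {1 - inverse (real (Suc j))<..<1}"
        using open_not_negligible[of "{1 - inverse (real (Suc j))<..<1}"] by simp
      then have "\<not> {1 - inverse (real (Suc j))<..<1} \<subseteq> N' \<union> {t \<in> {0..1}. J t \<noteq> 0}"
        using M negligible_subset by blast
      then obtain t where t: "t \<in> {1 - inverse (real (Suc j))<..<1}" "t \<notin> N'" "\<not> (t \<in> {0..1} \<and> J t \<noteq> 0)" by blast
      have "inverse (real (Suc j)) \<le> 1" by (simp add: inverse_le_1_iff)
      then have t01: "t \<in> {0<..<1}" using t(1) by auto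
      then have "0 \<in> field (\<sigma> t)" using key[of t] t by (auto simp: J_def N'_def)
      then show "\<exists>t. 1 - inverse (real (Suc j)) < t \<and> t < 1 \<and> 0 \<in> field (\<sigma> t)" using t(1) by auto
    qed
    from choice[OF this] obtain t where
      "\<forall>j. 1 - inverse (real (Suc j)) < t j \<and> t j < 1 \<and> 0 \<in> field (\<sigma> (t j))" by blast
    then have t: "\<And>j. 1 - inverse (real (Suc j)) < t j" "\<And>j. t j < 1" "\<And>j. 0 \<in> field (\<sigma> (t j))"
      by blast+
    have "(\<lambda>j. 1 - inverse (real (Suc j))) \<longlonglongrightarrow> 1 - 0"
      by (intro tendsto_diff tendsto_const LIMSEQ_inverse_real_of_nat)
    then have lim: "(\<lambda>j. 1 - inverse (real (Suc j))) \<longlonglongrightarrow> 1" by simp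
    have "t \<longlonglongrightarrow> 1"
      by (rule tendsto_sandwich[OF _ _ lim tendsto_const]) (intro always_eventually allI less_imp_le t)+
    then have "(\<lambda>j. \<sigma> (t j)) \<longlonglongrightarrow> \<sigma> 1"
      by (rule continuous_on_tendsto_compose[OF lipschitz_on_continuous_on[OF lip]]) auto
    from stationary_limit[OF this t(3)] ns show False by simp
  qed
  ultimately show ?thesis by simp
qed

text \<open>Time reversal and rescaling to the unit interval reduce this to \<open>ascent\<close>:
  the start of \<gamma> becomes the end of \<sigma>, and the length \<open>T\<close> becomes the
  speed factor.\<close>

lemma descent:
  assumes T: "0 < T" and lip: "K-lipschitz_on UNIV \<gamma>"
    and der: "\<forall>t\<in>{0<..<T}. \<forall>u. (\<gamma> has_vector_derivative u) (at t) \<longrightarrow> - u \<in> field (\<gamma> t)"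
    and ns: "0 \<notin> field (\<gamma> 0)"
  shows "hfun f \<beta> Hyy gy (\<gamma> T) < hfun f \<beta> Hyy gy (\<gamma> 0)"
proof -
  \<comment> \<open>Clamping confines the range of \<sigma> to a compact arc of \<gamma>, as the
    boundedness condition in \<open>ascent\<close> demands.\<close>
  define \<sigma> where "\<sigma> t = \<gamma> (T * (1 - max 0 (min 1 t)))" for t
  have K: "0 \<le> K" using lipschitz_on_nonneg[OF lip] .
  have "hfun f \<beta> Hyy gy (\<sigma> 0) < hfun f \<beta> Hyy gy (\<sigma> 1)"
  proof (rule ascent[OF _ _ T])
    show "(K * T)-lipschitz_on UNIV \<sigma>"
    proof (rule lipschitz_onI)
      fix s t
      have "dist (\<sigma> s) (\<sigma> t) \<le> K * dist (T * (1 - max 0 (min 1 s))) (T * (1 - max 0 (min 1 t)))"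
        unfolding \<sigma>_def by (rule lipschitz_onD[OF lip]) auto
      also have "\<dots> = K * T * \<bar>max 0 (min 1 s) - max 0 (min 1 t)\<bar>"
        unfolding dist_real_def right_diff_distrib[symmetric] abs_mult using T by (simp add: abs_minus_commute)
      also have "\<dots> \<le> K * T * dist s t"
        using K T by (intro mult_left_mono) (auto simp: dist_real_def)
      finally show "dist (\<sigma> s) (\<sigma> t) \<le> K * T * dist s t" .
    qed (use K T in simp)
    have "range \<sigma> \<subseteq> \<gamma> ` {0..T}"
      using T by (auto simp: \<sigma>_def intro!: image_eqI[of _ \<gamma>] mult_nonneg_nonneg mult_left_le)
    then show "bounded (range \<sigma>)"
      by (rule bounded_subset[rotated])
        (intro compact_imp_bounded compact_continuous_image compact_Icc
          continuous_on_subset[OF lipschitz_on_continuous_on[OF lip]] subset_UNIV)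
    show "\<exists>w\<in>field (\<sigma> t). u = T *\<^sub>R w"
      if t: "t \<in> {0<..<1}" and u: "(\<sigma> has_vector_derivative u) (at t)" for t u
    proof -
      define s0 where "s0 = T * (1 - t)"
      have s0: "s0 \<in> {0<..<T}" "1 - s0 / T = t" using t T by (auto simp: s0_def)
      have "((\<lambda>s. 1 - s / T) has_vector_derivative (- inverse T)) (at s0)"
        using T by (auto intro!: derivative_eq_intros simp: divide_inverse)
      from vector_diff_chain_at[OF this, of \<sigma> u]
      have "(\<sigma> \<circ> (\<lambda>s. 1 - s / T) has_vector_derivative (- inverse T) *\<^sub>R u) (at s0)"
        using u s0(2) by simp
      \<comment> \<open>Inside the open interval the clamping is inactive, so \<sigma> after the
        inverse time change is \<gamma>.\<close>
      then have "(\<gamma> has_vector_derivative (- inverse T) *\<^sub>R u) (at s0)"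
        by (rule has_vector_derivative_transform_within_open[of _ _ _ "{0<..<T}"])
          (use s0 T in \<open>auto simp: \<sigma>_def min_def max_def field_simps\<close>)
      then have "inverse T *\<^sub>R u \<in> field (\<gamma> s0)" using der s0(1) by fastforce
      moreover have "\<gamma> s0 = \<sigma> t" using t by (simp add: \<sigma>_def s0_def)
      ultimately show ?thesis using T by (intro bexI[of _ "inverse T *\<^sub>R u"]) auto
    qed
    show "0 \<notin> field (\<sigma> 1)" using ns by (simp add: \<sigma>_def)
  qed
  then show ?thesis by (simp add: \<sigma>_def)
qed

end

section \<open>The algorithm as a Lyapunov iteration\<close>

theorem theorem4p4:
  fixes f :: "(real^'n) \<times> (real^'p) \<Rightarrow> real"
    and g :: "(real^'n) \<times> (real^'p) \<Rightarrow> real"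
    and gx :: "(real^'n) \<times> (real^'p) \<Rightarrow> real^'n"
    and gy :: "(real^'n) \<times> (real^'p) \<Rightarrow> real^'p"
    and Hxy :: "(real^'n) \<times> (real^'p) \<Rightarrow> real^'p^'n"
    and Hyy :: "(real^'n) \<times> (real^'p) \<Rightarrow> real^'p^'p"
    and Df :: "(real^'n) \<times> (real^'p) \<Rightarrow> ((real^'n) \<times> (real^'p)) set"
    and Mf \<mu> Lg Qg \<beta> :: real
    and x :: "nat \<Rightarrow> real^'n" and y :: "nat \<Rightarrow> real^'p" and w :: "nat \<Rightarrow> real^'p"
    and dx :: "nat \<Rightarrow> real^'n" and dy :: "nat \<Rightarrow> real^'p"
    and \<eta> \<epsilon> :: "nat \<Rightarrow> real"
  assumes consts_pos: "Mf > 0" "\<mu> > 0" "Lg > 0" "Qg > 0"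
    \<comment> \<open>(A1)\<close>
    and f_lip: "Mf-lipschitz_on UNIV f"
    and g_grad: "\<And>z. (g has_derivative (\<lambda>(u, v). gx z \<bullet> u + gy z \<bullet> v)) (at z)"
    and gx_diff: "\<And>z. gx differentiable (at z)"
    and gy_deriv: "\<And>z. (gy has_derivative (\<lambda>(u, v). u v* Hxy z + Hyy z *v v)) (at z)"
    and Hyy_pd: "\<And>z v. v \<bullet> (Hyy z *v v) \<ge> \<mu> * (norm v)\<^sup>2"
    and grad_lip: "Lg-lipschitz_on UNIV (\<lambda>z. (gx z, gy z))"
    and Hyy_lip: "\<And>z z'. opnorm (Hyy z - Hyy z') \<le> Qg * dist z z'"
    and Hxy_lip: "\<And>z z'. opnorm (Hxy z - Hxy z') \<le> Qg * dist z z'"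
    and Hyy_C1: "\<exists>DH :: (real^'n) \<times> (real^'p) \<Rightarrow> ((real^'n) \<times> (real^'p)) \<Rightarrow>\<^sub>L (real^'p^'p).
                   (\<forall>z. (Hyy has_derivative blinfun_apply (DH z)) (at z)) \<and> continuous_on UNIV DH"
    \<comment> \<open>(A2)\<close>
    and Df_cons: "conservative_field Df"
    and f_pot: "potential_of f Df"
    and Df_convex: "\<And>z. convex (Df z)"
    and Df_bound: "\<And>z d. d \<in> Df z \<Longrightarrow> norm d \<le> Mf"
    \<comment> \<open>step size parameter\<close>
    and beta: "\<beta> \<ge> max (8 * Mf * Qg / \<mu> ^ 3) (4 * Mf * Qg * Lg / \<mu> powr 3.5)"
    \<comment> \<open>Algorithm 3\<close>
    and w_inexact: "\<And>k. norm (Hyy (x k, y k) *v w k - gy (x k, y k)) \<le> \<epsilon> k"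
    and d_choice: "\<And>k. (dx k, dy k) \<in> Df (x k, y k - w k)"
    and x_step: "\<And>k. x (Suc k) = x k - \<eta> k *\<^sub>R
                   (dx k - Hxy (x k, y k) *v (matrix_inv (Hyy (x k, y k)) *v dy k))"
    and y_step: "\<And>k. y (Suc k) = y k - \<eta> k *\<^sub>R
                   (\<beta> *\<^sub>R gy (x k, y k) - matrix_inv (Hyy (x k, y k)) *v
                      (transpose (Hxy (x k, y k)) *v
                        (dx k - Hxy (x k, y k) *v (matrix_inv (Hyy (x k, y k)) *v dy k))))"
    \<comment> \<open>(a), (b), (c), and vanishing inexactness\<close>
    and bdd: "\<exists>B. \<forall>k. norm (x k) + norm (y k) \<le> B"
    and eta_nonneg: "\<And>k. \<eta> k \<ge> 0"
    and eta_not_summable: "\<not> summable \<eta>"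
    and eta_sq_summable: "summable (\<lambda>k. (\<eta> k)\<^sup>2)"
    and crit_values: "interior {f z | z. BLO_stationary Df Hxy Hyy gy z} = {}"
    and eps_lim: "\<epsilon> \<longlonglongrightarrow> 0"
  shows "(\<forall>z r. strict_mono r \<and> ((\<lambda>k. (x (r k), y (r k))) \<longlonglongrightarrow> z)
            \<longrightarrow> BLO_stationary Df Hxy Hyy gy z)
         \<and> convergent (\<lambda>k. hfun f \<beta> Hyy gy (x k, y k))"
proof -
  have gy_lip: "norm (gy z' - gy z) \<le> Lg * norm (z' - z)" for z z'
    using lipschitz_onD[OF grad_lip, of z' z] dist_snd_le[of "(gx z', gy z')" "(gx z, gy z)"]
    by (simp add: dist_norm)
  \<comment> \<open>For fixed \<open>x\<close>, \<open>Hyy\<close> is the second derivative of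
    \<open>g\<close> in \<open>y\<close> and depends continuously on \<open>y\<close>, so mixed
    partial derivatives commute.\<close>
  have Hyy_sym: "(Hyy z *v b) \<bullet> a = (Hyy z *v a) \<bullet> b" for z a b
  proof -
    let ?x = "fst z"
    have emb: "(Pair ?x has_derivative (\<lambda>v. (0, v))) (at y)" for y :: "real^'p"
      by (auto intro!: derivative_eq_intros)
    have "((\<lambda>y. g (?x, y)) has_derivative (\<lambda>v. gy (?x, y) \<bullet> v)) (at y)" for y
      using has_derivative_compose[OF emb g_grad] by simp
    moreover have "((\<lambda>y. gy (?x, y)) has_derivative (\<lambda>v. Hyy (?x, y) *v v)) (at y)" for y
      using has_derivative_compose[OF emb gy_deriv] by simp
    moreover have "continuous_on UNIV (\<lambda>y. Hyy (?x, y) *v v)" for v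
    proof (rule lipschitz_on_continuous_on[OF lipschitz_onI])
      show "dist (Hyy (?x, y) *v v) (Hyy (?x, y') *v v) \<le> Qg * norm v * dist y y'" for y y'
        using opnorm_bound[OF Hyy_lip, of "(?x, y)" "(?x, y')" v]
        by (simp add: dist_norm matrix_vector_mult_diff_rdistrib ac_simps)
    qed (use consts_pos in simp)
    ultimately have "(Hyy (?x, snd z) *v b) \<bullet> a = (Hyy (?x, snd z) *v a) \<bullet> b"
      by (rule second_derivative_symmetric)
    then show ?thesis by simp
  qed
  interpret bilevel gy Hxy Hyy \<mu> Lg Qg f Df Mf \<beta>
    by unfold_locales
      (use consts_pos gy_deriv gy_lip Hyy_pd Hyy_sym Hyy_lip Hxy_lip f_lip f_pot Df_convex Df_bound Df_cons beta
        in \<open>auto simp: conservative_field_def ac_simps\<close>)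
  obtain B where B: "\<And>k. norm (x k) + norm (y k) \<le> B" using bdd by blast
  define z where "z k = (x k, y k)" for k
  define d where "d k = (dx k, dy k)" for k
  have d: "d k \<in> Df (x k, y k - w k)" for k using d_choice by (simp add: d_def)
  have z_bound: "norm (z k) \<le> B" for k
    using norm_Pair_le[of "x k" "y k"] B[of k] unfolding z_def by linarith
  have px_bound: "norm (px (z k) (d k)) \<le> (1 + Lg / \<mu>) * Mf" for k
    using norm_px[of "z k" "d k"] mult_left_mono[OF Df_bound[OF d[of k]], of "1 + Lg / \<mu>"] \<mu>_pos Lg_pos
    by (smt (verit) divide_pos_pos)
  have gy_bound: "norm (gy (z k)) \<le> norm (gy 0) + Lg * B" for k
  proof -
    have "norm (gy (z k)) \<le> norm (gy 0) + norm (gy (z k) - gy 0)"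
      using norm_triangle_ineq[of "gy 0" "gy (z k) - gy 0"] by simp
    also have "norm (gy (z k) - gy 0) \<le> Lg * B"
      using gy_lip[of "z k" 0] mult_left_mono[OF z_bound[of k] less_imp_le[OF Lg_pos]]
      unfolding diff_zero by linarith
    finally show ?thesis by simp
  qed
  \<comment> \<open>A uniform speed bound: bounded iterates bound \<open>gy\<close>, and
    \<open>Mf\<close> bounds the elements of \<open>Df\<close> that enter \<open>px\<close>.\<close>
  define V where "V = (1 + Lg / \<mu>) * Mf + \<beta> * (norm (gy 0) + Lg * B) + Lg / \<mu> * ((1 + Lg / \<mu>) * Mf)"
  have dir_bound: "norm (dir (z k) (d k)) \<le> V" for k
  proof -
    have "norm (dir (z k) (d k)) \<le> norm (px (z k) (d k)) + \<beta> * norm (gy (z k)) + Lg / \<mu> * norm (px (z k) (d k))"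
      by (rule norm_dir)
    also have "\<dots> \<le> V"
      unfolding V_def using \<beta>_pos Lg_pos \<mu>_pos
      by (intro add_mono mult_left_mono px_bound gy_bound) auto
    finally show ?thesis .
  qed
  \<comment> \<open>Coercivity of \<open>Hyy\<close> converts the residual of the linear solve into
    a distance from the exact Newton correction.\<close>
  have w_lim: "(\<lambda>k. w k - newton (z k)) \<longlonglongrightarrow> 0"
  proof (rule Lim_null_comparison)
    have "norm (w k - newton (z k)) \<le> \<epsilon> k / \<mu>" for k
    proof -
      have "Hyy (z k) *v (w k - newton (z k)) = Hyy (z k) *v w k - gy (z k)"
        by (simp add: matrix_vector_mult_diff_distrib newton_def)
      then have "norm (w k - newton (z k)) \<le> norm (Hyy (z k) *v w k - gy (z k)) / \<mu>"
        using norm_le_Hyy[of "w k - newton (z k)" "z k"] by simp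
      also have "\<dots> \<le> \<epsilon> k / \<mu>"
        using w_inexact[of k] \<mu>_pos unfolding z_def by (intro divide_right_mono) auto
      finally show ?thesis .
    qed
    then show "\<forall>\<^sub>F k in sequentially. norm (w k - newton (z k)) \<le> \<epsilon> k / \<mu>" by simp
    show "(\<lambda>k. \<epsilon> k / \<mu>) \<longlonglongrightarrow> 0" by (rule tendsto_divide_zero[OF eps_lim])
  qed
  interpret lyapunov_iteration z "\<lambda>k. dir (z k) (d k)" \<eta> V B field "hfun f \<beta> Hyy gy" "{p. 0 \<in> field p}"
  proof unfold_locales
    show "z (Suc k) = z k - \<eta> k *\<^sub>R dir (z k) (d k)" for k
      by (simp add: z_def d_def dir_def px_def Hinv_def x_step y_step del: transpose_matrix_vector)
    show "\<eta> \<longlonglongrightarrow> 0"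
    proof -
      have "(\<lambda>k. (\<eta> k)\<^sup>2) \<longlonglongrightarrow> 0" by (rule summable_LIMSEQ_zero[OF eta_sq_summable])
      from tendsto_real_sqrt[OF this] show ?thesis using eta_nonneg by simp
    qed
    show "u \<in> field p"
      if r: "strict_mono r" and p: "(\<lambda>j. z (r j)) \<longlonglongrightarrow> p" and u: "(\<lambda>j. dir (z (r j)) (d (r j))) \<longlonglongrightarrow> u"
      for r p u
    proof (rule field_limit[OF p _ _ u])
      have "(\<lambda>j. w (r j) - newton (z (r j))) \<longlonglongrightarrow> 0"
        using LIMSEQ_subseq_LIMSEQ[OF w_lim r] by (simp add: o_def)
      from tendsto_diff[OF Amap_tendsto[OF p] this]
      have "(\<lambda>j. y (r j) - w (r j)) \<longlonglongrightarrow> Amap Hyy gy p" by (simp add: Amap_eq z_def)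
      from tendsto_Pair[OF tendsto_fst[OF p] this]
      show "(\<lambda>j. (x (r j), y (r j) - w (r j))) \<longlonglongrightarrow> (fst p, Amap Hyy gy p)" by (simp add: z_def)
    qed (rule d)
    show "interior (hfun f \<beta> Hyy gy ` {p. 0 \<in> field p}) = {}"
    proof -
      have "hfun f \<beta> Hyy gy ` {p. 0 \<in> field p} = {f z |z. BLO_stationary Df Hxy Hyy gy z}"
        unfolding zero_in_field_iff using hfun_stationary by (auto simp: image_def)
      then show ?thesis using crit_values by simp
    qed
    show "hfun f \<beta> Hyy gy (\<gamma> T) < hfun f \<beta> Hyy gy (\<gamma> 0)"
      if "0 < T" "V-lipschitz_on UNIV \<gamma>"
        "\<forall>t\<in>{0<..<T}. \<forall>u. (\<gamma> has_vector_derivative u) (at t) \<longrightarrow> - u \<in> field (\<gamma> t)"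
        "\<gamma> 0 \<notin> {p. 0 \<in> field p}" for \<gamma> T
      using descent[OF that(1-3)] that(4) by simp
  qed (use dir_bound z_bound eta_nonneg eta_not_summable convex_field closed_field hfun_continuous in auto)
  show ?thesis
    using h_convergent limit_point_in_S unfolding zero_in_field_iff z_def by blast
qed

end
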